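(* Let $\zeta_5$ be a primitive fifth root of unity. Then \[ \frac{(-q;q)_\infty}{(q;q)_\infty}\Bigl(\frac12+\sum_{n=1}^\infty\frac{(1-\zeta_5)(1-\zeta_5^{-1})(-1)^nq^n}{(1-\zeta_5q^n)(1-\zeta_5^{-1}q^n)}\Bigr)=\sum_{r=0}^4q^rB_r(q^5), \] where \begin{align*} B_0(q)&=\frac{(q^5;q^5)_\infty^2(q^4,q^6;q^{10})_\infty}{2(q^{10};q^{10})_\infty(q^2,q^3;q^5)_\infty^2}+(\zeta_5+\zeta_5^{-1})\frac{q(q^{10};q^{10})_\infty}{(q^3,q^4,q^6,q^7;q^{10})_\infty},\\ B_1(q)&=(\zeta_5+\zeta_5^{-1}-1)\frac{(q^4,q^6,q^{10};q^{10})_\infty}{(q^2,q^8;q^{10})_\infty^2(q^3,q^7;q^{10})_\infty},\\ B_2(q)&=(1-2\zeta_5-2\zeta_5^{-1})\frac{(q^{10};q^{10})_\infty}{(q,q^9;q^{10})_\infty(q^4,q^6;q^{10})_\infty},\\ B_3(q)&=-\frac{(q^{10};q^{10})_\infty}{(q^2,q^3;q^5)_\infty},\\ B_4(q)&=(\zeta_5+\zeta_5^{-1})\frac{(q^2,q^8,q^{10};q^{10})_\infty}{(q,q^9;q^{10})_\infty(q^4,q^6;q^{10})_\infty^2}. \end{align*}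
   Context: $(a;q)_\infty=\prod_{k\ge0}(1-aq^k)$ and $(a_1,\dots,a_j;q)_\infty=(a_1;q)_\infty\cdots(a_j;q)_\infty$; identities are of formal power series in $q$. *)

theory Defs
  imports Complex_Main "HOL-Computational_Algebra.Formal_Power_Series"
begin

text \<open>Infinite q-Pochhammer symbol (c q^j; q^d)_\<infinity> = prod_{k>=0} (1 - c q^(j + d k)),
  as a formal power series with complex coefficients, defined as the limit of the
  partial products in the standard (X-adic) topology on formal power series.\<close>
definition qpoch :: "complex \<Rightarrow> nat \<Rightarrow> nat \<Rightarrow> complex fps" where
  "qpoch c j d = lim (\<lambda>N. \<Prod>k<N. (1 - fps_const c * fps_X ^ (j + d * k)))"

abbreviation qp :: "nat \<Rightarrow> nat \<Rightarrow> complex fps" where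
  "qp j d \<equiv> qpoch 1 j d"

abbreviation cst :: "complex \<Rightarrow> complex fps" where
  "cst c \<equiv> fps_const c"

definition B0 :: "complex \<Rightarrow> complex fps" where
  "B0 z = (qp 5 5)^2 * qp 4 10 * qp 6 10 / (cst 2 * qp 10 10 * (qp 2 5 * qp 3 5)^2)
        + cst (z + inverse z) * (fps_X * qp 10 10 / (qp 3 10 * qp 4 10 * qp 6 10 * qp 7 10))"

definition B1 :: "complex \<Rightarrow> complex fps" where
  "B1 z = cst (z + inverse z - 1) *
     (qp 4 10 * qp 6 10 * qp 10 10 / ((qp 2 10 * qp 8 10)^2 * (qp 3 10 * qp 7 10)))"

definition B2 :: "complex \<Rightarrow> complex fps" where
  "B2 z = cst (1 - 2 * z - 2 * inverse z) *
     (qp 10 10 / ((qp 1 10 * qp 9 10) * (qp 4 10 * qp 6 10)))"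

definition B3 :: "complex \<Rightarrow> complex fps" where
  "B3 z = - (qp 10 10 / (qp 2 5 * qp 3 5))"

definition B4 :: "complex \<Rightarrow> complex fps" where
  "B4 z = cst (z + inverse z) *
     (qp 2 10 * qp 8 10 * qp 10 10 / ((qp 1 10 * qp 9 10) * (qp 4 10 * qp 6 10)^2))"

definition B :: "nat \<Rightarrow> complex \<Rightarrow> complex fps" where
  "B r z = (if r = 0 then B0 z else if r = 1 then B1 z else if r = 2 then B2 z
            else if r = 3 then B3 z else B4 z)"

end

theory Submission
  imports Defs "HOL-Analysis.Infinite_Sum" "HOL-Computational_Algebra.Formal_Laurent_Series"
begin

text \<open>
  For K(z) = 1/2 + sum_{n >= 1} (1 - z)(1 - 1/z)(-1)^n q^n / ((1 - z q^n)(1 - q^n/z)) one has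
  K(z) = (q;q)^2 (-zq,-q/z;q) / (2 (-q;q)^2 (zq,q/z;q)). Since the factors for z, z^2 and 1 combine
  to products in q^5, the left-hand side equals (-q^5;q^5)/(q^5;q^5) K(-z^2), and K(-z^2) is the
  Lambert series (1 - a) S_1 + a S_2 with a = z + 1/z and S_s = sum_{n in Z} (-1)^n q^(sn)/(1 + q^(5n)).
  Splitting S_s by n mod 5 gives inner sums of the form sum_n y^n/(1 - x p^n), each of
  which is a single product by Kronecker's identity. Both Lambert series identities are limits of
  partial fraction expansions of finite products. The two-term relation needed for B_0 comes from
  Kronecker's identity as well, by splitting such a sum according to the parity of n.
\<close>

text \<open>With x = q^n, the denominator in K(-z^2) is 1 - (1 + a) x + x^2, a factor of 1 + x^5
  with cofactor (1 + x)(1 + a x + x^2). Since a^2 = 1 - a, multiplying the cofactor by (1 - a) x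
  gives (1 - a)(x + x^4) + a (x^2 + x^3): these four powers are the terms n and -n of S_1 and S_2.
  K(z) itself would lead to denominators 1 - q^(5n), singular at n = 0; passing to -z^2 avoids this
  and also leaves a prefactor in q^5. The bilateral sums involve negative powers of q. Finite
  identities are therefore proved over an arbitrary field, used for Laurent series and pulled back
  along the injection \<open>fps_to_fls\<close>; limits are taken modulo powers of q. Kronecker's
  identity is used in the range s + r <= p, where every term is a power series. One residue class in
  each kind of dissection leaves this range and is brought back by n -> -1 - n. After dissection,
  class 4 of S_1 and class 3 of S_2 vanish, while two pairs of classes coincide because the product
  is symmetric in s and r. This produces the coefficients 1 - 2a in B_2 and -1 in B_3.\<close>

instance fps :: (comm_ring_1) topological_comm_monoid_add
proof
  fix a b :: "'a fps"
  show "((\<lambda>x. fst x + snd x) \<longlongrightarrow> a + b) (nhds a \<times>\<^sub>F nhds b)"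
  proof (rule tendsto_fpsI)
    fix n
    have A: "filterlim fst (nhds a) (nhds a \<times>\<^sub>F nhds b)" "filterlim snd (nhds b) (nhds a \<times>\<^sub>F nhds b)"
      by (auto intro: filterlim_fst filterlim_snd)
    hence "\<forall>\<^sub>F x in nhds a \<times>\<^sub>F nhds b. fst x $ n = a $ n" "\<forall>\<^sub>F x in nhds a \<times>\<^sub>F nhds b. snd x $ n = b $ n"
      unfolding tendsto_fps_iff by blast+
    thus "\<forall>\<^sub>F x in nhds a \<times>\<^sub>F nhds b. (fst x + snd x) $ n = (a + b) $ n"
      by eventually_elim simp
  qed
qed

text \<open>Convergence here means that each coefficient is eventually constant, and coefficient n
  of a product depends only on coefficients up to n of the factors. The two instances make the
  \<open>has_sum\<close> rules for addition and constant multiples applicable to power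
  series.\<close>

instance fps :: (comm_ring_1) topological_semigroup_mult
proof
  fix a b :: "'a fps"
  show "((\<lambda>x. fst x * snd x) \<longlongrightarrow> a * b) (nhds a \<times>\<^sub>F nhds b)"
  proof (rule tendsto_fpsI)
    fix n
    have A: "filterlim fst (nhds a) (nhds a \<times>\<^sub>F nhds b)" "filterlim snd (nhds b) (nhds a \<times>\<^sub>F nhds b)"
      by (auto intro: filterlim_fst filterlim_snd)
    hence "\<forall>\<^sub>F x in nhds a \<times>\<^sub>F nhds b. \<forall>k\<in>{..n}. fst x $ k = a $ k" 
          "\<forall>\<^sub>F x in nhds a \<times>\<^sub>F nhds b. \<forall>k\<in>{..n}. snd x $ k = b $ k"
      unfolding tendsto_fps_iff by (auto intro!: eventually_ball_finite)
    thus "\<forall>\<^sub>F x in nhds a \<times>\<^sub>F nhds b. (fst x * snd x) $ n = (a * b) $ n"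
      by eventually_elim (auto simp: fps_mult_nth intro!: sum.cong)
  qed
qed

section \<open>Congruence of power series modulo powers of X\<close>

definition fcong :: "nat \<Rightarrow> 'a::comm_ring_1 fps \<Rightarrow> 'a fps \<Rightarrow> bool" where
  "fcong N a b \<longleftrightarrow> fps_X ^ N dvd a - b"

lemma fcong_refl [simp]: "fcong N a a"
  by (simp add: fcong_def)

lemma fcong_sym: "fcong N a b \<Longrightarrow> fcong N b a"
  unfolding fcong_def by (metis dvd_minus_iff minus_diff_eq)

lemma fcong_trans [trans]: "fcong N a b \<Longrightarrow> fcong N b c \<Longrightarrow> fcong N a c"
  unfolding fcong_def using dvd_add[of "fps_X ^ N" "a - b" "b - c"] by simp

lemma fcong_mono: "fcong N a b \<Longrightarrow> M \<le> N \<Longrightarrow> fcong M a b"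
  unfolding fcong_def by (meson dvd_trans le_imp_power_dvd)

lemma fcong_add: "fcong N a b \<Longrightarrow> fcong N c d \<Longrightarrow> fcong N (a + c) (b + d)"
  unfolding fcong_def by (metis add_diff_add dvd_add)

lemma fcong_mult: 
  assumes "fcong N a b" "fcong N c d" 
  shows   "fcong N (a * c) (b * d)"
proof -
  have "a * c - b * d = (a - b) * c + b * (c - d)" by (simp add: algebra_simps)
  thus ?thesis using assms unfolding fcong_def by (metis dvd_add dvd_mult dvd_mult2)
qed

lemma fcong_sum: "(\<And>x. x \<in> A \<Longrightarrow> fcong N (f x) (g x)) \<Longrightarrow> fcong N (sum f A) (sum g A)"
  unfolding fcong_def by (simp flip: sum_subtractf add: dvd_sum)

lemma fcong_prod: "(\<And>x. x \<in> A \<Longrightarrow> fcong N (f x) (g x)) \<Longrightarrow> fcong N (prod f A) (prod g A)"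
  by (induction A rule: infinite_finite_induct) (auto intro: fcong_mult)

lemma fcong_power: "fcong N a b \<Longrightarrow> fcong N (a ^ n) (b ^ n)"
  by (induction n) (auto intro: fcong_mult)

lemma fcong_inverse:
  fixes a b :: "'a::field fps"
  assumes "fcong N a b" "a $ 0 \<noteq> 0" "b $ 0 \<noteq> 0" 
  shows   "fcong N (inverse a) (inverse b)"
proof -
  have "inverse a - inverse b = (b - a) * (inverse a * inverse b)"
    using inverse_mult_eq_1[OF assms(2)] inverse_mult_eq_1[OF assms(3)] by algebra
  thus ?thesis using fcong_sym[OF assms(1)] unfolding fcong_def by (metis dvd_mult2)
qed

text \<open>A factor X^M buys M further orders of precision. In both limit arguments below this
  repays the loss caused by truncated products that are shorter for terms of larger index.\<close>

lemma fcong_mult_left: "fcong N a b \<Longrightarrow> fcong (M + N) (fps_X ^ M * a) (fps_X ^ M * b)"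
  unfolding fcong_def by (metis mult_dvd_mono dvd_refl power_add right_diff_distrib)

lemma fcong_nth: "fcong N a b \<Longrightarrow> n < N \<Longrightarrow> a $ n = b $ n"
  unfolding fcong_def dvd_def by (metis eq_iff_diff_eq_0 fps_X_power_mult_nth fps_sub_nth)

lemma fcong_eqI: 
  assumes "\<And>N. N \<ge> N0 \<Longrightarrow> fcong (N - c) a b" 
  shows   "a = b"
proof (rule fps_ext)
  fix n show "a $ n = b $ n"
    using fcong_nth[OF assms[of "N0 + c + n + 1"], of n] by simp
qed

lemma fcong_compose:
  fixes a b :: "'a::idom fps"
  assumes "fcong N a b" "m > 0"
  shows   "fcong N (a oo fps_X ^ m) (b oo fps_X ^ m)"
proof -
  obtain c where c: "a - b = fps_X ^ N * c" 
    using assms unfolding fcong_def dvd_def by blast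
  have "(a oo fps_X ^ m) - (b oo fps_X ^ m) = (fps_X ^ N * c) oo fps_X ^ m"
    by (simp flip: c add: fps_compose_sub_distrib)
  also have "\<dots> = fps_X ^ (m * N) * (c oo fps_X ^ m)"
    using assms(2) by (simp add: fps_compose_mult_distrib fps_X_power_compose power_mult)
  finally show ?thesis
    using assms(2) unfolding fcong_def
    by (metis dvd_mult2 dvd_refl le_imp_power_dvd mult.commute nat_mult_le_cancel1 One_nat_def Suc_leI mult_le_mono2 nat_mult_1_right)
qed

section \<open>Truncated q-products and their limits\<close>

definition qpart :: "complex \<Rightarrow> nat \<Rightarrow> nat \<Rightarrow> nat \<Rightarrow> complex fps" where
  "qpart c j d N = (\<Prod>k<N. (1 - cst c * fps_X ^ (j + d * k)))"

text \<open>All factors with index at least N are 1 modulo X^(j + d N).\<close>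

lemma qpart_fcong:
  assumes "d > 0" "N \<le> M" "K \<le> j + d * N"
  shows   "fcong K (qpart c j d M) (qpart c j d N)"
  using assms(2)
proof (induction M rule: dec_induct)
  case (step M)
  have "K \<le> j + d * M"
    using step assms by (meson add_left_mono le_trans mult_le_mono2)
  hence "fcong K (qpart c j d M * (1 - cst c * fps_X ^ (j + d * M))) (qpart c j d M * 1)"
    by (intro fcong_mult) (auto simp: fcong_def le_imp_power_dvd)
  with step.IH show ?case by (auto simp: qpart_def intro: fcong_trans)
qed auto

lemma fps_limI:
  fixes f :: "nat \<Rightarrow> 'a :: comm_ring_1 fps"
  assumes "\<And>n M. M \<ge> g n \<Longrightarrow> f M $ n = f (g n) $ n"
  shows   "f \<longlonglongrightarrow> Abs_fps (\<lambda>n. f (g n) $ n)"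
  unfolding tendsto_fps_iff by (auto simp: eventually_at_top_linorder intro!: exI assms)

text \<open>Since \<open>qpoch\<close> is defined by \<open>lim\<close>, convergence has to come
  first. For d > 0, coefficient n is already final in the product of n + 1 factors.\<close>

lemma qpart_tendsto: 
  assumes "d > 0" 
  shows   "qpart c j d \<longlonglongrightarrow> qpoch c j d"
proof -
  have "qpart c j d M $ n = qpart c j d (n + 1) $ n" if "M \<ge> n + 1" for M n
  proof (rule fcong_nth[OF qpart_fcong, of d "n + 1" M "n + 1"])
    show "n + 1 \<le> j + d * (n + 1)" using assms by (cases d) auto
  qed (use assms that in auto)
  hence "qpart c j d \<longlonglongrightarrow> Abs_fps (\<lambda>n. qpart c j d (n + 1) $ n)"
    by (rule fps_limI)
  thus ?thesis unfolding qpoch_def qpart_def using limI by fastforce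
qed

lemma fcong_tendsto:
  assumes "f \<longlonglongrightarrow> L" "eventually (\<lambda>M. fcong N (f M) b) sequentially"
  shows   "fcong N L b"
proof -
  have "\<forall>\<^sub>F M in sequentially. \<forall>k\<in>{..<N}. f M $ k = L $ k"
    using assms(1) unfolding tendsto_fps_iff by (auto intro!: eventually_ball_finite)
  with assms(2) have "\<forall>\<^sub>F M in sequentially. \<forall>k\<in>{..<N}. b $ k = L $ k"
    by eventually_elim (use fcong_nth in fastforce)
  hence *: "\<forall>k<N. (L - b) $ k = 0" by (auto dest: eventually_happens)
  have "L - b = fps_X ^ N * fps_shift N (L - b)"
    by (rule fps_ext) (use * in \<open>simp add: fps_X_power_mult_nth\<close>)
  thus ?thesis unfolding fcong_def by (metis dvd_triv_left)
qed

lemma qpoch_fcong: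
  assumes "d > 0" "K \<le> j + d * N"
  shows   "fcong K (qpoch c j d) (qpart c j d N)"
  by (rule fcong_tendsto[OF qpart_tendsto])
     (use assms in \<open>auto simp: eventually_at_top_linorder intro!: exI[of _ N] qpart_fcong\<close>)

lemma qpoch_fcong': "d > 0 \<Longrightarrow> fcong N (qpoch c j d) (qpart c j d N)"
  by (rule qpoch_fcong) (auto intro: trans_le_add2)

lemma qpart_nth_0: "j > 0 \<or> (d > 0 \<and> c \<noteq> 1) \<Longrightarrow> qpart c j d N $ 0 \<noteq> 0"
  unfolding qpart_def by (induction N) (auto simp: power_0_left)

subsection \<open>Partial fractions over a field\<close>

text \<open>The right-hand side is a polynomial of degree below \<open>card I\<close> that agrees
  with p at all \<open>card I\<close> nodes. Dividing by a product that vanishes exactly at the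
  nodes turns interpolation into a partial fraction expansion; this is the algebraic source of both
  series identities.\<close>

lemma lagrange_interpolation:
  fixes p :: "'a::field poly"
  assumes I: "finite I" "inj_on a I" "degree p < card I"
  shows "poly p x = (\<Sum>i\<in>I. poly p (a i) * (\<Prod>j\<in>I - {i}. (x - a j) / (a i - a j)))"
proof -
  define q where "q = (\<Sum>i\<in>I. smult (poly p (a i)) (\<Prod>j\<in>I - {i}. smult (1 / (a i - a j)) [:- a j, 1:]))"
  have poly_q: "poly q t = (\<Sum>i\<in>I. poly p (a i) * (\<Prod>j\<in>I - {i}. (t - a j) / (a i - a j)))" for t
    by (simp add: q_def poly_sum poly_prod diff_divide_distrib)
  have "degree (smult (poly p (a i)) (\<Prod>j\<in>I - {i}. smult (1 / (a i - a j)) [:- a j, 1:])) \<le> card I - 1" 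
    if "i \<in> I" for i
  proof -
    have "degree (\<Prod>j\<in>I - {i}. smult (1 / (a i - a j)) [:- a j, 1:]) \<le> 
          (\<Sum>j\<in>I - {i}. degree (smult (1 / (a i - a j)) [:- a j, 1:]))"
      using degree_prod_sum_le[of "I - {i}" "\<lambda>j. smult (1 / (a i - a j)) [:- a j, 1:]"] I(1)
      by (simp only: o_def finite_Diff)
    also have "\<dots> \<le> (\<Sum>j\<in>I - {i}. 1)"
      by (intro sum_mono) auto
    also have "\<dots> = card I - 1" using that I by simp
    finally show ?thesis using degree_smult_le le_trans by blast
  qed
  hence "degree q \<le> card I - 1" unfolding q_def by (intro degree_sum_le) (use I in auto)
  hence deg: "degree q < card I" using I(3) by linarith
  have "p = q"
  proof (rule poly_eqI_degree)
    fix t assume "t \<in> a ` I"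
    then obtain k where k: "k \<in> I" "t = a k" by auto
    have "poly p (a i) * (\<Prod>j\<in>I - {i}. (t - a j) / (a i - a j)) = (if i = k then poly p t else 0)" 
      if "i \<in> I" for i
    proof (cases "i = k")
      case True
      have "(\<Prod>j\<in>I - {i}. (t - a j) / (a i - a j)) = (\<Prod>j\<in>I - {i}. 1)"
        by (rule prod.cong) (use True k I(2) in \<open>auto simp: inj_on_def\<close>)
      thus ?thesis using True k by simp
    next
      case False
      hence "\<exists>j\<in>I - {i}. (t - a j) / (a i - a j) = 0" using k by auto
      hence "(\<Prod>j\<in>I - {i}. (t - a j) / (a i - a j)) = 0" using I(1) by (simp add: prod_zero_iff)
      thus ?thesis using False by simp
    qed
    hence "poly q t = (\<Sum>i\<in>I. if i = k then poly p t else 0)"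
      unfolding poly_q by (intro sum.cong) auto
    thus "poly p t = poly q t" using k I(1) by simp
  qed (use deg I card_image[OF I(2)] in auto)
  thus ?thesis by (metis poly_q)
qed

text \<open>The finite q-Pochhammer symbol (a;P)_n. A general field is taken so that arguments like
  P/y are available.\<close>

definition field_qpoch :: "'a::field \<Rightarrow> 'a \<Rightarrow> nat \<Rightarrow> 'a" where
  "field_qpoch a P n = (\<Prod>k<n. 1 - a * P ^ k)"

lemma prod_lessThan_split:
  fixes f :: "nat \<Rightarrow> 'a::comm_monoid_mult"
  shows "m \<le> n \<Longrightarrow> (\<Prod>k<n. f k) = (\<Prod>k<m. f k) * (\<Prod>k<n - m. f (m + k))"
proof -
  assume "m \<le> n"
  have "(\<Prod>k<m + l. f k) = (\<Prod>k<m. f k) * (\<Prod>k<l. f (m + k))" for l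
    by (induction l) (auto simp: mult_ac)
  from this[of "n - m"] \<open>m \<le> n\<close> show ?thesis by simp
qed

lemma prod_atMost_remove_split:
  fixes f :: "nat \<Rightarrow> 'a::comm_monoid_mult"
  assumes "m \<le> n" 
  shows "(\<Prod>k\<in>{..n} - {m}. f k) = (\<Prod>k<m. f k) * (\<Prod>k<n - m. f (Suc m + k))"
proof -
  have eq: "{..n} - {m} = {..<m} \<union> {Suc m..n}" using assms by auto
  have "(\<Prod>k\<in>{..n} - {m}. f k) = (\<Prod>k<m. f k) * (\<Prod>k\<in>{Suc m..n}. f k)"
    unfolding eq by (rule prod.union_disjoint) auto
  also have "(\<Prod>k\<in>{Suc m..n}. f k) = (\<Prod>k<n - m. f (Suc m + k))"
    by (rule prod.reindex_bij_witness[of _ "\<lambda>k. Suc m + k" "\<lambda>k. k - Suc m"]) (use assms in auto)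
  finally show ?thesis .
qed

text \<open>The factors on the left are 1 - y P^(-1), ..., 1 - y P^(-m). Pulling -y P^(-(k+1)) out
  of each leaves 1 - (P/y) P^k, so negative powers of P become a symbol in P/y times a
  monomial.\<close>

lemma field_qpoch_reverse:
  fixes P y :: "'a::field"
  assumes "P \<noteq> 0" "y \<noteq> 0"
  shows "(\<Prod>k<m. 1 - y * (P ^ k / P ^ m)) = y ^ m * (\<Prod>k<m. - 1 / P ^ Suc k) * field_qpoch (P / y) P m"
proof -
  have "(\<Prod>k<m. 1 - y * (P ^ k / P ^ m)) = (\<Prod>k<m. y * (- 1 / P ^ Suc k) * (1 - P / y * P ^ k))"
  proof (rule prod.reindex_bij_witness[of _ "\<lambda>k. m - Suc k" "\<lambda>k. m - Suc k"])
    fix k assume "k \<in> {..<m}"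
    hence "m = k + (m - k)" "m - k \<noteq> 0" by auto
    then obtain l where l: "m = k + Suc l" by (metis not0_implies_Suc)
    show "y * (- 1 / P ^ Suc (m - Suc k)) * (1 - P / y * P ^ (m - Suc k)) = 1 - y * (P ^ k / P ^ m)"
      using assms by (simp add: l power_add field_simps)
  qed auto
  also have "\<dots> = y ^ m * (\<Prod>k<m. - 1 / P ^ Suc k) * field_qpoch (P / y) P m"
    by (simp only: prod.distrib field_qpoch_def prod_constant) simp
  finally show ?thesis .
qed

lemma field_qpoch_shift:
  assumes "P \<noteq> 0" "N \<le> M"
  shows "(\<Prod>k<M - N. 1 - y * (P ^ (N + k) / P ^ N)) = field_qpoch y P (M - N)"
  using assms by (simp add: field_qpoch_def power_add)

lemma field_qpoch_nonzero: "(\<And>k. k < n \<Longrightarrow> a * P ^ k \<noteq> 1) \<Longrightarrow> field_qpoch a P n \<noteq> 0"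
  by (auto simp: field_qpoch_def)

text \<open>Cleared of denominators, this is the partial fraction expansion in u of (uy;P)_M /
  (u;P)_(M+1), with poles u = P^(-m). The numerator has degree at most M and is interpolated at
  these M + 1 points, which are distinct because P^k is not 1 for 0 < k <= M.\<close>

lemma finite_partial_fractions:
  fixes P y u :: "'a::field"
  assumes P: "P \<noteq> 0" "y \<noteq> 0" "\<And>k. 0 < k \<Longrightarrow> k \<le> M \<Longrightarrow> P ^ k \<noteq> 1"
  shows "(\<Prod>k<M. 1 - u * y * P ^ k) =
         (\<Sum>m\<le>M. y ^ m * (field_qpoch y P (M - m) * field_qpoch (P / y) P m / (field_qpoch P P (M - m) * field_qpoch P P m)) *
                  (\<Prod>j\<in>{..M} - {m}. 1 - u * P ^ j))"
proof -
  define p where "p = (\<Prod>k<M. [:1, - (y * P ^ k):])"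
  have ne: "P ^ i \<noteq> P ^ j" if "i < j" "j \<le> M" for i j
  proof
    assume *: "P ^ i = P ^ j"
    have "P ^ j = P ^ i * P ^ (j - i)" using that by (simp flip: power_add)
    hence "P ^ (j - i) = 1" using * P by simp
    thus False using P(3)[of "j - i"] that by auto
  qed
  hence inj: "inj_on (\<lambda>j. 1 / P ^ j) {..M}"
    using P by (intro linorder_inj_onI) (auto simp: field_simps; metis)+
  have "degree p \<le> (\<Sum>k<M. degree [:1, - (y * P ^ k):])"
    unfolding p_def using degree_prod_sum_le[of "{..<M}" "\<lambda>k. [:1, - (y * P ^ k):]"]
    by (simp only: o_def finite_lessThan)
  also have "\<dots> \<le> (\<Sum>k<M. 1)" by (intro sum_mono) auto
  finally have deg: "degree p < card {..M}" by simp
  have poly_p: "poly p t = (\<Prod>k<M. 1 - t * y * P ^ k)" for t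
    by (simp add: p_def poly_prod mult_ac)
  have Pne: "field_qpoch P P m \<noteq> 0" if "m \<le> M" for m
    using P(3)[of "Suc _"] that by (intro field_qpoch_nonzero) auto
  have pre: "(\<Prod>k<m. - 1 / P ^ Suc k) \<noteq> 0" for m using P by auto
  \<comment> \<open>The residue at u = P^(-m) up to normalisation. Both products are cut at index m
    and their lower parts reversed; the product of the -1/P^(k+1) then occurs above and below and
    cancels.\<close>
  have coeff: "poly p (1 / P ^ m) / (\<Prod>j\<in>{..M} - {m}. 1 - 1 * (P ^ j / P ^ m)) = 
        y ^ m * (field_qpoch y P (M - m) * field_qpoch (P / y) P m / (field_qpoch P P (M - m) * field_qpoch P P m))"
    if m: "m \<le> M" for m
  proof -
    have "poly p (1 / P ^ m) = (\<Prod>k<M. 1 - y * (P ^ k / P ^ m))"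
      by (simp add: poly_p mult_ac)
    also have "\<dots> = y ^ m * (\<Prod>k<m. - 1 / P ^ Suc k) * field_qpoch (P / y) P m * field_qpoch y P (M - m)"
      unfolding prod_lessThan_split[OF m] using field_qpoch_reverse[of P y m] field_qpoch_shift[of P m M y] P m by simp
    finally have 1: "poly p (1 / P ^ m) = y ^ m * (\<Prod>k<m. - 1 / P ^ Suc k) * field_qpoch (P / y) P m * field_qpoch y P (M - m)" .
    have "(\<Prod>j\<in>{..M} - {m}. 1 - 1 * (P ^ j / P ^ m)) = 
          (\<Prod>k<m. 1 - 1 * (P ^ k / P ^ m)) * (\<Prod>k<M - m. 1 - 1 * (P ^ (Suc m + k) / P ^ m))"
      by (rule prod_atMost_remove_split[OF m])
    also have "(\<Prod>k<m. 1 - 1 * (P ^ k / P ^ m)) = (\<Prod>k<m. - 1 / P ^ Suc k) * field_qpoch P P m"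
      using field_qpoch_reverse[of P 1 m] P by simp
    also have "(\<Prod>k<M - m. 1 - 1 * (P ^ (Suc m + k) / P ^ m)) = field_qpoch P P (M - m)"
      using P by (simp add: field_qpoch_def power_add mult_ac)
    finally have 2: "(\<Prod>j\<in>{..M} - {m}. 1 - 1 * (P ^ j / P ^ m)) = 
       (\<Prod>k<m. - 1 / P ^ Suc k) * field_qpoch P P m * field_qpoch P P (M - m)" .
    show ?thesis unfolding 1 2 using pre[of m] by (simp add: divide_simps Pne m)
  qed
  have "poly p u = (\<Sum>m\<le>M. poly p (1 / P ^ m) * (\<Prod>j\<in>{..M} - {m}. (u - 1 / P ^ j) / (1 / P ^ m - 1 / P ^ j)))"
    by (rule lagrange_interpolation) (use inj deg in auto)
  also have "\<dots> = (\<Sum>m\<le>M. poly p (1 / P ^ m) / (\<Prod>j\<in>{..M} - {m}. 1 - 1 * (P ^ j / P ^ m)) * (\<Prod>j\<in>{..M} - {m}. 1 - u * P ^ j))"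
  proof (intro sum.cong refl)
    fix m assume m: "m \<in> {..M}"
    have "(\<Prod>j\<in>{..M} - {m}. (u - 1 / P ^ j) / (1 / P ^ m - 1 / P ^ j)) = 
          (\<Prod>j\<in>{..M} - {m}. (1 - u * P ^ j) / (1 - 1 * (P ^ j / P ^ m)))"
    proof (intro prod.cong refl)
      fix j assume j: "j \<in> {..M} - {m}"
      hence "P ^ j \<noteq> P ^ m" using m ne[of j m] ne[of m j] by (cases j m rule: linorder_cases) auto
      thus "(u - 1 / P ^ j) / (1 / P ^ m - 1 / P ^ j) = (1 - u * P ^ j) / (1 - 1 * (P ^ j / P ^ m))"
        using P by (simp add: divide_simps) (simp add: algebra_simps)?
    qed
    thus "poly p (1 / P ^ m) * (\<Prod>j\<in>{..M} - {m}. (u - 1 / P ^ j) / (1 / P ^ m - 1 / P ^ j)) = 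
      poly p (1 / P ^ m) / (\<Prod>j\<in>{..M} - {m}. 1 - 1 * (P ^ j / P ^ m)) * (\<Prod>j\<in>{..M} - {m}. 1 - u * P ^ j)"
      by (simp add: prod_dividef)
  qed
  also have "\<dots> = (\<Sum>m\<le>M. y ^ m * (field_qpoch y P (M - m) * field_qpoch (P / y) P m / (field_qpoch P P (M - m) * field_qpoch P P m)) *
                  (\<Prod>j\<in>{..M} - {m}. 1 - u * P ^ j))"
    by (intro sum.cong refl) (simp only: coeff atMost_iff)
  finally show ?thesis by (simp add: poly_p)
qed

text \<open>A truncation of Kronecker's identity for the sum over n of y^n / (1 - z P^n). It is the
  preceding expansion with M = 2N poles besides the first, centred by a shift of u; the remaining
  quotient of q-symbols in each term tends to a value independent of n.\<close>

lemma finite_kronecker: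
  fixes P y z :: "'a::field"
  assumes P: "P \<noteq> 0" "y \<noteq> 0" "z \<noteq> 0" "\<And>k. 0 < k \<Longrightarrow> k \<le> 2 * N \<Longrightarrow> P ^ k \<noteq> 1"
    and z: "\<And>k. k \<le> N \<Longrightarrow> z * P ^ k \<noteq> 1" "\<And>k. 0 < k \<Longrightarrow> k \<le> N \<Longrightarrow> P ^ k \<noteq> z"
  shows "field_qpoch (z * y) P N * field_qpoch (P / (z * y)) P N / (field_qpoch z P (Suc N) * field_qpoch (P / z) P N) =
         (\<Sum>m\<le>2 * N. y ^ m / y ^ N / (1 - z * P ^ m / P ^ N) * 
            (field_qpoch y P (2 * N - m) * field_qpoch (P / y) P m / (field_qpoch P P (2 * N - m) * field_qpoch P P m)))"
proof -
  \<comment> \<open>Dividing by P^N centres the poles: index m now stands for n = m - N between -N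
    and N. The lower half of each product has negative powers and is reversed.\<close>
  define u where "u = z / P ^ N"
  define C where "C = (\<Prod>k<N. - 1 / P ^ Suc k)"
  have C: "C \<noteq> 0" using P by (auto simp: C_def)
  have num: "(\<Prod>k<2 * N. 1 - u * y * P ^ k) = (z * y) ^ N * C * field_qpoch (P / (z * y)) P N * field_qpoch (z * y) P N"
  proof -
    have "(\<Prod>k<2 * N. 1 - u * y * P ^ k) = (\<Prod>k<2 * N. 1 - (z * y) * (P ^ k / P ^ N))"
      by (simp add: u_def)
    thus ?thesis
      using prod_lessThan_split[of N "2 * N" "\<lambda>k. 1 - (z * y) * (P ^ k / P ^ N)"] 
            field_qpoch_reverse[of P "z * y" N] field_qpoch_shift[of P N "2 * N" "z * y"] P by (simp add: C_def)
  qed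
  define D where "D = (\<Prod>k\<le>2 * N. 1 - u * P ^ k)"
  have den: "D = z ^ N * C * field_qpoch (P / z) P N * field_qpoch z P (Suc N)"
  proof -
    have "D = (\<Prod>k<Suc (2 * N). 1 - z * (P ^ k / P ^ N))"
      by (simp add: u_def D_def lessThan_Suc_atMost)
    thus ?thesis
      using prod_lessThan_split[of N "Suc (2 * N)" "\<lambda>k. 1 - z * (P ^ k / P ^ N)"] 
            field_qpoch_reverse[of P z N] field_qpoch_shift[of P N "Suc (2 * N)" "z"] P 
      by (simp add: C_def Suc_diff_le del: prod.lessThan_Suc)
  qed
  have "field_qpoch z P (Suc N) \<noteq> 0" using z(1) by (intro field_qpoch_nonzero) auto
  moreover have "field_qpoch (P / z) P N \<noteq> 0"
  proof (intro field_qpoch_nonzero)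
    fix k assume "k < N"
    thus "P / z * P ^ k \<noteq> 1" using z(2)[of "Suc k"] P by (simp add: field_simps)
  qed
  ultimately have D: "D \<noteq> 0" and D': "field_qpoch z P (Suc N) \<noteq> 0" "field_qpoch (P / z) P N \<noteq> 0" using C P by (auto simp: den)
  have "field_qpoch (z * y) P N * field_qpoch (P / (z * y)) P N / (field_qpoch z P (Suc N) * field_qpoch (P / z) P N) =
        (\<Prod>k<2 * N. 1 - u * y * P ^ k) / y ^ N / D"
    unfolding num den using C P by (simp add: power_mult_distrib divide_simps D')
  also have "\<dots> = (\<Sum>m\<le>2 * N. y ^ m * (field_qpoch y P (2 * N - m) * field_qpoch (P / y) P m / (field_qpoch P P (2 * N - m) * field_qpoch P P m)) *
                  (\<Prod>j\<in>{..2 * N} - {m}. 1 - u * P ^ j)) / y ^ N / D"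
    by (subst finite_partial_fractions) (use P in auto)
  also have "\<dots> = (\<Sum>m\<le>2 * N. y ^ m * (field_qpoch y P (2 * N - m) * field_qpoch (P / y) P m / (field_qpoch P P (2 * N - m) * field_qpoch P P m)) *
                  (\<Prod>j\<in>{..2 * N} - {m}. 1 - u * P ^ j) / y ^ N / D)"
    by (simp only: sum_divide_distrib)
  also have "\<dots> = (\<Sum>m\<le>2 * N. y ^ m / y ^ N / (1 - z * P ^ m / P ^ N) * 
            (field_qpoch y P (2 * N - m) * field_qpoch (P / y) P m / (field_qpoch P P (2 * N - m) * field_qpoch P P m)))"
  proof (intro sum.cong refl)
    fix m assume m: "m \<in> {..2 * N}"
    have Dm: "D = (1 - u * P ^ m) * (\<Prod>j\<in>{..2 * N} - {m}. 1 - u * P ^ j)"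
      unfolding D_def using m by (simp add: prod.remove)
    with D have "(\<Prod>j\<in>{..2 * N} - {m}. 1 - u * P ^ j) / D = 1 / (1 - u * P ^ m)" by simp
    hence *: "A * (\<Prod>j\<in>{..2 * N} - {m}. 1 - u * P ^ j) / y ^ N / D = A / y ^ N / (1 - u * P ^ m)" for A
      by (metis (no_types, lifting) divide_divide_eq_left' mult.commute times_divide_eq_left times_divide_eq_right mult_1)
    have uz: "z * P ^ m / P ^ N = u * P ^ m" by (simp add: u_def)
    show "y ^ m * (field_qpoch y P (2 * N - m) * field_qpoch (P / y) P m / (field_qpoch P P (2 * N - m) * field_qpoch P P m)) *
                  (\<Prod>j\<in>{..2 * N} - {m}. 1 - u * P ^ j) / y ^ N / D = 
          y ^ m / y ^ N / (1 - z * P ^ m / P ^ N) * 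
            (field_qpoch y P (2 * N - m) * field_qpoch (P / y) P m / (field_qpoch P P (2 * N - m) * field_qpoch P P m))"
      unfolding uz * by simp
  qed
  finally show ?thesis .
qed

text \<open>Here the interpolation variable is x, which plays the role of z + 1/z: each factor is
  linear in x, and the denominator vanishes at P^i + P^(-i) for 1 <= i <= N. A further node 2, the
  case i = 0, supplies the N + 1 points needed for degree N; it gives the squared leading term and
  puts the factor 2 - x into all others.\<close>

lemma finite_reciprocal_theta_quotient:
  fixes P x :: "'a::field"
  assumes P: "P \<noteq> 0" "\<And>k. 0 < k \<Longrightarrow> k \<le> 2 * N \<Longrightarrow> P ^ k \<noteq> 1"
    and x: "\<And>k. 0 < k \<Longrightarrow> k \<le> N \<Longrightarrow> 1 - x * P ^ k + (P ^ k)\<^sup>2 \<noteq> 0"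
  shows "(\<Prod>k\<in>{1..N}. (1 + x * P ^ k + (P ^ k)\<^sup>2) / (1 - x * P ^ k + (P ^ k)\<^sup>2)) =
         (field_qpoch (- P) P N / field_qpoch P P N)\<^sup>2 +
         (\<Sum>i\<in>{1..N}. 2 * (- 1) ^ i * P ^ i * (2 - x) / (1 - x * P ^ i + (P ^ i)\<^sup>2) *
            (field_qpoch (- P) P (N - i) * field_qpoch (- P) P (N + i) / (field_qpoch P P (N - i) * field_qpoch P P (N + i))))"
proof -
  define p where "p = (\<Prod>k\<in>{1..N}. [:1 + (P ^ k)\<^sup>2, P ^ k:])"
  define a where "a i = P ^ i + 1 / P ^ i" for i
  define D where "D j = 1 - x * P ^ j + (P ^ j)\<^sup>2" for j
  define PD where "PD = (\<Prod>j\<in>{1..N}. D j)"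
  have poly_p: "poly p t = (\<Prod>k\<in>{1..N}. 1 + t * P ^ k + (P ^ k)\<^sup>2)" for t
    by (simp add: p_def poly_prod algebra_simps)
  have Dne: "D j \<noteq> 0" if "j \<in> {1..N}" for j using x that by (auto simp: D_def)
  hence PD: "PD \<noteq> 0" by (simp add: PD_def)
  have ne: "1 - P ^ k \<noteq> 0" if "0 < k" "k \<le> 2 * N" for k using P(2)[OF that] by auto
  have ne': "1 + P ^ k \<noteq> 0" if "0 < k" "k \<le> N" for k
  proof
    assume "1 + P ^ k = 0"
    hence "P ^ k = -1" by (simp add: add_eq_0_iff)
    hence "P ^ (2 * k) = 1" by (simp add: power_mult mult.commute[of 2])
    thus False using P(2)[of "2 * k"] that by auto
  qed
  \<comment> \<open>This factorisation splits the interpolation denominators into products over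
    P^(i+j) and over P^(j-i), each of which is a q-symbol up to a few factors.\<close>
  have node: "a i - a j = - ((1 - P ^ (i + j)) * (1 - P ^ j / P ^ i)) / P ^ j" for i j
    using P(1) by (simp add: a_def field_simps power_add power2_eq_square)
  have nej: "1 - P ^ j / P ^ i \<noteq> 0" if "i \<noteq> j" "i \<le> N" "j \<le> N" for i j
  proof (cases "i < j")
    case True
    hence "P ^ j = P ^ i * P ^ (j - i)" by (simp flip: power_add)
    thus ?thesis using ne[of "j - i"] True that P by simp
  next
    case False
    hence "P ^ i = P ^ j * P ^ (i - j)" by (simp flip: power_add)
    thus ?thesis using ne[of "i - j"] False that P by (simp add: divide_simps)
  qed
  have inj: "inj_on a {..N}"
  proof (rule inj_onI, rule ccontr)
    fix i j assume ij: "i \<in> {..N}" "j \<in> {..N}" "a i = a j" "i \<noteq> j"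
    have "(1 - P ^ (i + j)) * (1 - P ^ j / P ^ i) / P ^ j = 0" using node[of i j] ij by simp
    moreover have "1 - P ^ (i + j) \<noteq> 0" using ij by (intro ne) auto
    ultimately show False using nej[of i j] ij P by simp
  qed
  have "degree p \<le> (\<Sum>k\<in>{1..N}. degree [:1 + (P ^ k)\<^sup>2, P ^ k:])"
    unfolding p_def using degree_prod_sum_le[of "{1..N}" "\<lambda>k. [:1 + (P ^ k)\<^sup>2, P ^ k:]"]
    by (simp only: o_def finite_atLeastAtMost)
  also have "\<dots> \<le> (\<Sum>k\<in>{1..N}. 1)" by (intro sum_mono) auto
  finally have deg: "degree p < card {..N}" by simp
  have Dnode: "x - a j = - D j / P ^ j" for j
    using P(1) by (simp add: a_def D_def field_simps power2_eq_square)
  have "poly p x = (\<Sum>i\<le>N. poly p (a i) * (\<Prod>j\<in>{..N} - {i}. (x - a j) / (a i - a j)))"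
    by (rule lagrange_interpolation) (use inj deg in auto)
  also have "\<dots> = (\<Sum>i\<le>N. poly p (a i) * (\<Prod>j\<in>{..N} - {i}. D j) / 
      ((\<Prod>j\<in>{..N} - {i}. 1 - P ^ (i + j)) * (\<Prod>j\<in>{..N} - {i}. 1 - P ^ j / P ^ i)))"
    using P(1) by (simp add: node Dnode prod_dividef prod.distrib)
  finally have main: "poly p x / PD = (\<Sum>i\<le>N. (\<Prod>j\<in>{..N} - {i}. D j) / PD * (poly p (a i) / 
      ((\<Prod>j\<in>{..N} - {i}. 1 - P ^ (i + j)) * (\<Prod>j\<in>{..N} - {i}. 1 - P ^ j / P ^ i))))"
    by (simp add: sum_divide_distrib mult_ac)
  have pa: "poly p (a i) = (\<Prod>k\<in>{1..N}. 1 + P ^ (k + i)) * (\<Prod>k\<in>{1..N}. 1 + P ^ k / P ^ i)" for i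
    unfolding poly_p prod.distrib[symmetric]
    by (rule prod.cong) (use P(1) in \<open>simp_all add: a_def field_simps power_add power2_eq_square\<close>)
  have qm: "field_qpoch (- P) P n = (\<Prod>k\<in>{1..n}. 1 + P ^ k)" "field_qpoch P P n = (\<Prod>k\<in>{1..n}. 1 - P ^ k)" for n
    unfolding field_qpoch_def by (rule prod.reindex_bij_witness[of _ "\<lambda>k. k - 1" Suc]; auto)+
  have t0: "(\<Prod>j\<in>{..N} - {0}. D j) / PD * (poly p (a 0) / 
      ((\<Prod>j\<in>{..N} - {0}. 1 - P ^ (0 + j)) * (\<Prod>j\<in>{..N} - {0}. 1 - P ^ j / P ^ 0))) = 
      (field_qpoch (- P) P N / field_qpoch P P N)\<^sup>2"
  proof -
    have "{..N} - {0} = {1..N}" by auto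
    thus ?thesis using PD by (simp add: PD_def pa qm power2_eq_square)
  qed
  have ti: "(\<Prod>j\<in>{..N} - {i}. D j) / PD * (poly p (a i) / 
      ((\<Prod>j\<in>{..N} - {i}. 1 - P ^ (i + j)) * (\<Prod>j\<in>{..N} - {i}. 1 - P ^ j / P ^ i))) = 
      2 * (- 1) ^ i * P ^ i * (2 - x) / (1 - x * P ^ i + (P ^ i)\<^sup>2) *
            (field_qpoch (- P) P (N - i) * field_qpoch (- P) P (N + i) / (field_qpoch P P (N - i) * field_qpoch P P (N + i)))"
    if i: "i \<in> {1..N}" for i
  proof -
    define C where "C = (\<Prod>k<i. - 1 / P ^ Suc k)"
    have C: "C \<noteq> 0" using P by (auto simp: C_def)
    have Pne: "field_qpoch P P n \<noteq> 0" if "n \<le> 2 * N" for n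
      unfolding qm using ne that by auto
    have Pne': "field_qpoch (-P) P n \<noteq> 0" if "n \<le> N" for n
      unfolding qm using ne' that by auto
    have "(\<Prod>j\<in>{..N} - {i}. D j) * D i = (\<Prod>j\<in>{..N}. D j)"
      using i by (subst prod.remove[of "{..N}" i]) (auto simp: mult.commute)
    also have "\<dots> = D 0 * PD"
      unfolding PD_def by (simp add: atMost_atLeast0 prod.atLeast_Suc_atMost)
    also have "D 0 = 2 - x" by (simp add: D_def)
    finally have 1: "(\<Prod>j\<in>{..N} - {i}. D j) / PD = (2 - x) / D i"
      using PD Dne[OF i] by (simp add: field_simps)
    have "(\<Prod>k\<in>{1..N}. 1 + P ^ (k + i)) * field_qpoch (-P) P i = field_qpoch (-P) P (N + i)"
    proof -
      have "(\<Prod>k\<in>{1..N}. 1 + P ^ (k + i)) = (\<Prod>k<N. 1 + P ^ (Suc i + k))"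
        by (rule prod.reindex_bij_witness[of _ "\<lambda>k. Suc k" "\<lambda>k. k - 1"]) (auto simp: add_ac)
      thus ?thesis using prod_lessThan_split[of i "N + i" "\<lambda>k. 1 - (-P) * P ^ k"]
        by (simp add: field_qpoch_def mult_ac power_add)
    qed
    hence 2: "(\<Prod>k\<in>{1..N}. 1 + P ^ (k + i)) = field_qpoch (-P) P (N + i) / field_qpoch (-P) P i"
      using Pne'[of i] i by (simp add: field_simps)
    \<comment> \<open>Adjoining the factor k = 0 gives a full run of powers from P^(-i) to P^(N-i).
      Its factor 1 + P^0 at k = i is the 2 of the statement, and removing 1 + P^(-i) again
      contributes P^i / (1 + P^i).\<close>
    have "(\<Prod>k\<in>{1..N}. 1 + P ^ k / P ^ i) * (1 + 1 / P ^ i) = (\<Prod>k<Suc N. 1 - (-1) * (P ^ k / P ^ i))"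
      by (simp add: lessThan_Suc_atMost atMost_atLeast0 prod.atLeast_Suc_atMost mult_ac del: prod.lessThan_Suc)
    also have "\<dots> = ((-1) ^ i * C * field_qpoch (-P) P i) * (\<Prod>k<Suc N - i. 1 - (-1) * (P ^ (i + k) / P ^ i))"
      using prod_lessThan_split[of i "Suc N" "\<lambda>k. 1 - (-1) * (P ^ k / P ^ i)"] i 
        field_qpoch_reverse[of P "-1" i] P(1) by (simp add: C_def del: prod.lessThan_Suc)
    also have "(\<Prod>k<Suc N - i. 1 - (-1) * (P ^ (i + k) / P ^ i)) = (\<Prod>k<Suc (N - i). 1 + P ^ k)"
      using i P(1) by (simp add: power_add Suc_diff_le)
    also have "\<dots> = 2 * field_qpoch (-P) P (N - i)"
      by (subst prod.lessThan_Suc_shift) (simp add: field_qpoch_def)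
    finally have 3: "(\<Prod>k\<in>{1..N}. 1 + P ^ k / P ^ i) = 
         2 * (-1) ^ i * C * field_qpoch (-P) P i * field_qpoch (-P) P (N - i) * P ^ i / (1 + P ^ i)"
      using ne'[of i] i P(1) by (simp add: field_simps)
    have "(\<Prod>j\<in>{..N} - {i}. 1 - P ^ j / P ^ i) = (\<Prod>k<i. 1 - 1 * (P ^ k / P ^ i)) * (\<Prod>k<N - i. 1 - P ^ (Suc i + k) / P ^ i)"
      using i by (subst prod_atMost_remove_split) auto
    also have "(\<Prod>k<i. 1 - 1 * (P ^ k / P ^ i)) = C * field_qpoch P P i"
      using field_qpoch_reverse[of P 1 i] P(1) by (simp add: C_def)
    also have "(\<Prod>k<N - i. 1 - P ^ (Suc i + k) / P ^ i) = field_qpoch P P (N - i)"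
      using P(1) by (simp add: field_qpoch_def power_add)
    finally have 4: "(\<Prod>j\<in>{..N} - {i}. 1 - P ^ j / P ^ i) = C * field_qpoch P P i * field_qpoch P P (N - i)" .
    \<comment> \<open>The missing factor j = i is 1 - P^(2i) = (1 - P^i)(1 + P^i). Its first part
      cancels against j = 0, its second part against the 1 + P^i found above.\<close>
    have "(\<Prod>j\<in>{..N} - {i}. 1 - P ^ (i + j)) * (1 - P ^ (i + i)) = (\<Prod>j\<in>{..N}. 1 - P ^ (i + j))"
      using i by (subst prod.remove[of "{..N}" i]) (auto simp: mult.commute)
    also have "\<dots> * field_qpoch P P i = (1 - P ^ i) * field_qpoch P P (N + i)"
    proof -
      have "(\<Prod>j\<in>{..N}. 1 - P ^ (i + j)) = (1 - P ^ i) * (\<Prod>j\<in>{1..N}. 1 - P ^ (i + j))"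
        by (simp add: atMost_atLeast0 prod.atLeast_Suc_atMost)
      also have "(\<Prod>k\<in>{1..N}. 1 - P ^ (i + k)) = (\<Prod>k<N. 1 - P ^ (Suc i + k))"
        by (rule prod.reindex_bij_witness[of _ "\<lambda>k. Suc k" "\<lambda>k. k - 1"]) (auto simp: add_ac)
      finally show ?thesis using prod_lessThan_split[of i "N + i" "\<lambda>k. 1 - P * P ^ k"]
        by (simp add: field_qpoch_def mult_ac power_add)
    qed
    finally have 5: "(\<Prod>j\<in>{..N} - {i}. 1 - P ^ (i + j)) = field_qpoch P P (N + i) / (field_qpoch P P i * (1 + P ^ i))"
    proof -
      assume *: "(\<Prod>j\<in>{..N} - {i}. 1 - P ^ (i + j)) * (1 - P ^ (i + i)) * field_qpoch P P i = (1 - P ^ i) * field_qpoch P P (N + i)"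
      have "1 - P ^ (i + i) = (1 - P ^ i) * (1 + P ^ i)" by (simp add: power_add algebra_simps)
      with * ne[of i] i have "(\<Prod>j\<in>{..N} - {i}. 1 - P ^ (i + j)) * (1 + P ^ i) * field_qpoch P P i = field_qpoch P P (N + i)"
        by (simp add: mult_ac)
      thus ?thesis using ne'[of i] Pne[of i] i by (subst nonzero_eq_divide_eq) (auto simp: mult_ac)
    qed
    show ?thesis unfolding 1 pa 2 3 4 5 D_def[symmetric]
      using C Pne[of i] Pne[of "N - i"] Pne[of "N + i"] Pne'[of i] ne'[of i] Dne[OF i] i 
      by (simp add: divide_simps) 
  qed
  have "(\<Prod>k\<in>{1..N}. (1 + x * P ^ k + (P ^ k)\<^sup>2) / (1 - x * P ^ k + (P ^ k)\<^sup>2)) = poly p x / PD"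
    by (simp add: poly_p PD_def D_def prod_dividef)
  also have "\<dots> = (field_qpoch (- P) P N / field_qpoch P P N)\<^sup>2 +
         (\<Sum>i\<in>{1..N}. 2 * (- 1) ^ i * P ^ i * (2 - x) / (1 - x * P ^ i + (P ^ i)\<^sup>2) *
            (field_qpoch (- P) P (N - i) * field_qpoch (- P) P (N + i) / (field_qpoch P P (N - i) * field_qpoch P P (N + i))))"
  proof -
    have "{..N} = insert 0 {1..N}" by auto
    thus ?thesis unfolding main using t0 ti by simp
  qed
  finally show ?thesis .
qed

subsection \<open>Lambert series as theta quotients\<close>

lemma qpoch_nth_0: "j > 0 \<Longrightarrow> d > 0 \<Longrightarrow> qpoch c j d $ 0 = 1"
  using fcong_nth[OF qpoch_fcong[of d 1 j 0 c], of 0] by (simp add: qpart_def)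

lemma le_add_mult: "0 < d \<Longrightarrow> N \<le> j + d * (N :: nat)"
  by (cases d) auto

lemma qpoch_fcong_0: "d > 0 \<Longrightarrow> fcong N (qpoch c 0 d) ((1 - cst c) * qpoch c d d)"
proof -
  assume d: "d > 0"
  have "fcong N (qpoch c 0 d) (qpart c 0 d (Suc N))"
    using d le_add_mult[of d N d] by (intro qpoch_fcong) auto
  also have "qpart c 0 d (Suc N) = (1 - cst c) * qpart c d d N"
    unfolding qpart_def prod.lessThan_Suc_shift by simp
  also have "fcong N \<dots> ((1 - cst c) * qpoch c d d)"
    by (intro fcong_mult fcong_refl fcong_sym[OF qpoch_fcong'] d)
  finally show ?thesis .
qed

text \<open>Exponent 0 occurs in the class r = 0. The split-off factor is 2 for c = -1, the origin
  of the 1/2 in B_0, and 0 for c = 1, which makes whole residue classes vanish.\<close>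

lemma qpoch_0: "d > 0 \<Longrightarrow> qpoch c 0 d = (1 - cst c) * qpoch c d d"
  by (rule fcong_eqI[of 0 0]) (simp add: qpoch_fcong_0)

lemma qpoch_nth_0_nonzero: "d > 0 \<Longrightarrow> j > 0 \<or> c \<noteq> 1 \<Longrightarrow> qpoch c j d $ 0 \<noteq> 0"
  by (cases "j = 0") (auto simp: qpoch_nth_0 qpoch_0)

section \<open>Transfer between power series and Laurent series\<close>

lemma fps_to_fls_mult_inverse:
  fixes a b :: "'a::field fps"
  assumes "b $ 0 \<noteq> 0"
  shows "fps_to_fls (a * inverse b) = fps_to_fls a / fps_to_fls b"
  using assms by (simp add: fls_times_fps_to_fls divide_inverse fls_inverse_fps_to_fls)

lemma fps_to_fls_divide_unit:
  fixes f g :: "'a::field fps"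
  shows "g $ 0 \<noteq> 0 \<Longrightarrow> fps_to_fls (f / g) = fps_to_fls f / fps_to_fls g"
  by (simp add: fps_divide_unit fps_to_fls_mult_inverse)

lemma fps_to_fls_prod: "fps_to_fls (prod f A) = (\<Prod>x\<in>A. fps_to_fls (f x :: 'a::comm_ring_1 fps))"
  by (induction A rule: infinite_finite_induct) (auto simp: fls_times_fps_to_fls)

lemma fps_to_fls_sum: "fps_to_fls (sum f A) = (\<Sum>x\<in>A. fps_to_fls (f x :: 'a::comm_ring_1 fps))"
  by (induction A rule: infinite_finite_induct) auto

lemma fps_to_fls_qpart:
  "fps_to_fls (qpart c j d N) = field_qpoch (fls_const c * fls_X ^ j) (fls_X ^ d) N"
  by (simp add: qpart_def field_qpoch_def fps_to_fls_prod fls_times_fps_to_fls fps_to_fls_power power_add power_mult mult.assoc)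

text \<open>The expansion of X^e / (1 - c X^f) for c = 1 or c = -1; for negative f the fraction is
  expanded in powers of X^(-f).\<close>
definition lambert_frac :: "complex \<Rightarrow> int \<Rightarrow> int \<Rightarrow> complex fps" where
  "lambert_frac c e f = (if f \<ge> 0 then fps_X ^ nat e * inverse (1 - cst c * fps_X ^ nat f)
                 else - cst c * (fps_X ^ nat (e - f) * inverse (1 - cst c * fps_X ^ nat (- f))))"

lemma fls_X_neq_0: "(fls_X :: 'a::{zero_neq_one} fls) \<noteq> 0"
  by simp

text \<open>Both branches represent the same Laurent fraction because 1 - c X^f = -c X^f (1 - c
  X^(-f)) when c^2 = 1. The bounds on e ensure that \<open>nat\<close> truncates no
  exponent.\<close>

lemma fps_to_fls_lambert_frac:
  assumes c: "c * c = 1" "f = 0 \<longrightarrow> c \<noteq> 1" and ef: "f \<ge> 0 \<longrightarrow> e \<ge> 0" "f < 0 \<longrightarrow> e \<ge> f"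
  shows "fps_to_fls (lambert_frac c e f) = fls_X powi e / (1 - fls_const c * fls_X powi f)"
proof (cases "f \<ge> 0")
  case True
  have 1: "(1 - cst c * fps_X ^ nat f) $ 0 \<noteq> 0"
    using c True by (auto simp: power_0_left)
  have "lambert_frac c e f = fps_X ^ nat e * inverse (1 - cst c * fps_X ^ nat f)"
    using True by (simp add: lambert_frac_def)
  thus ?thesis using True ef
    by (simp only: fps_to_fls_mult_inverse[OF 1]) (simp add: fps_to_fls_power power_int_def fls_times_fps_to_fls)
next
  case False
  define A where "A = (fls_X :: complex fls) powi f"
  define E where "E = (fls_X :: complex fls) powi e"
  have A: "A \<noteq> 0" by (simp add: A_def)
  have 1: "(1 - cst c * fps_X ^ nat (-f)) $ 0 \<noteq> 0" using False by (auto simp: power_0_left)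
  have c1: "fls_const c * fls_const c = 1" using c(1) by (simp add: fls_const_mult_const)
  have XA: "fls_X ^ nat (- f) = 1 / A"
  proof -
    have "A = fls_X powi (- int (nat (- f)))" unfolding A_def using False by simp
    thus ?thesis by (simp only: power_int_minus power_int_of_nat divide_inverse inverse_inverse_eq mult_1_left)
  qed
  have "fps_to_fls (lambert_frac c e f) = - fls_const c * (fls_X ^ nat (e - f) / (1 - fls_const c * fls_X ^ nat (- f)))"
  proof -
    have "lambert_frac c e f = - cst c * (fps_X ^ nat (e - f) * inverse (1 - cst c * fps_X ^ nat (- f)))"
      using False by (simp add: lambert_frac_def)
    thus ?thesis
      by (simp only: fls_times_fps_to_fls[of "- cst c"] fps_to_fls_mult_inverse[OF 1])
         (simp add: fps_to_fls_power fls_times_fps_to_fls)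
  qed
  also have "fls_X ^ nat (e - f) = E / A" using ef False by (simp add: E_def A_def flip: power_int_diff power_int_of_nat)
  also have "fls_X ^ nat (- f) = 1 / A" by (rule XA)
  also have "- fls_const c * (E / A / (1 - fls_const c * (1 / A))) = E / (1 - fls_const c * A)"
  proof -
    have ne: "1 - fls_const c * (1 / A) \<noteq> 0" 
    proof -
      have "fps_to_fls (1 - cst c * fps_X ^ nat (-f)) \<noteq> 0"
        using 1 by (intro fps_to_fls_nonzeroI) force
      thus ?thesis unfolding XA[symmetric] by (simp add: fls_times_fps_to_fls fps_to_fls_power)
    qed
    have "1 - fls_const c * A = - (fls_const c * A) * (1 - fls_const c * (1 / A))"
      using c1 A by (simp add: algebra_simps)
    moreover have "fls_const c \<noteq> 0" using c(1) by auto
    ultimately show ?thesis using ne A c1 by (simp add: divide_simps) (simp add: algebra_simps)?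
  qed
  finally show ?thesis by (simp add: E_def A_def)
qed

lemma lambert_frac_dvd: 
  "f \<ge> 0 \<Longrightarrow> int k \<le> e \<Longrightarrow> fps_X ^ k dvd lambert_frac c e f" 
  "f < 0 \<Longrightarrow> int k \<le> e - f \<Longrightarrow> fps_X ^ k dvd lambert_frac c e f"
proof -
  have *: "fps_X ^ k dvd (fps_X ^ l :: complex fps) * a" if "k \<le> l" for l a
    using that by (intro dvd_mult2 le_imp_power_dvd)
  show "f \<ge> 0 \<Longrightarrow> int k \<le> e \<Longrightarrow> fps_X ^ k dvd lambert_frac c e f" 
    using * by (simp add: lambert_frac_def)
  show "fps_X ^ k dvd lambert_frac c e f" if "f < 0" "int k \<le> e - f"
  proof -
    have "lambert_frac c e f = - cst c * (fps_X ^ nat (e - f) * inverse (1 - cst c * fps_X ^ nat (- f)))"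
      using that by (simp add: lambert_frac_def)
    moreover have "k \<le> nat (e - f)" using that by auto
    ultimately show ?thesis using dvd_mult[OF *] by metis
  qed
qed

lemma lambert_frac_reflect:
  assumes "c * c = 1" "f = 0 \<longrightarrow> c = -1"
  shows "lambert_frac c e f = - cst c * lambert_frac c (e - f) (- f)"
  using assms by (auto simp: lambert_frac_def mult.assoc[symmetric] numeral_fps_const)

text \<open>Terms of large index do not touch a fixed coefficient, so every finite index set
  containing a large symmetric interval gives the same coefficient. Unordered summability thus
  reduces to symmetric partial sums; r is a fixed loss of precision.\<close>

lemma has_sum_int_fcongI:
  fixes F :: "int \<Rightarrow> 'a::comm_ring_1 fps"
  assumes dvd: "\<And>n. fps_X ^ (nat \<bar>n\<bar> - r) dvd F n"
    and cong: "\<And>N. fcong (N - r) (\<Sum>n\<in>{-int N..int N}. F n) S"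
  shows "(F has_sum S) UNIV"
  unfolding has_sum_def
proof (rule tendsto_fpsI)
  fix k :: nat
  define N where "N = k + r + 1"
  have "\<forall>\<^sub>F A in finite_subsets_at_top UNIV. finite A \<and> {-int N..int N} \<subseteq> A"
    unfolding eventually_finite_subsets_at_top by (rule exI[of _ "{-int N..int N}"]) auto
  thus "\<forall>\<^sub>F A in finite_subsets_at_top UNIV. sum F A $ k = S $ k"
  proof eventually_elim
    case (elim A)
    have 0: "F n $ k = 0" if "n \<notin> {-int N..int N}" for n
    proof -
      have "k < nat \<bar>n\<bar> - r" using that by (auto simp: N_def)
      thus ?thesis using fcong_nth[of "nat \<bar>n\<bar> - r" "F n" 0 k] dvd[of n] by (simp add: fcong_def)
    qed
    have "sum F A $ k = (\<Sum>n\<in>A. F n $ k)" by (simp add: fps_sum_nth)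
    also have "\<dots> = (\<Sum>n\<in>{-int N..int N}. F n $ k)"
      by (rule sum.mono_neutral_right) (use elim 0 in auto)
    also have "\<dots> = S $ k" using fcong_nth[OF cong[of N], of k] by (simp add: fps_sum_nth N_def)
    finally show ?case .
  qed
qed

text \<open>The n-th term of Kronecker's series with base q^p, y = c q^s and x = c q^r. Both
  arguments carry the same sign c, so their product q^(s+r) has none.\<close>

definition lambert_term :: "complex \<Rightarrow> nat \<Rightarrow> nat \<Rightarrow> nat \<Rightarrow> int \<Rightarrow> complex fps" where
  "lambert_term c s r p n = cst (c powi n) * lambert_frac c (int s * n) (int r + int p * n)"

text \<open>For n < 0 the expansion starts at exponent s n - (r + p n) = (p - s)|n| - r. The
  condition s + r <= p says p - s >= r, which makes this nonnegative; p - s >= 1 makes it at least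
  |n| - r.\<close>

lemma lambert_term_exponents:
  fixes s r p n :: int
  assumes "0 < s" "s < p" "0 \<le> r" "s + r \<le> p"
  shows "0 \<le> r + p * n \<Longrightarrow> n \<ge> 0" 
    and "r + p * n < 0 \<Longrightarrow> n < 0 \<and> s * n - (r + p * n) \<ge> \<bar>n\<bar> - r \<and> s * n - (r + p * n) \<ge> 0"
proof -
  show "n \<ge> 0" if "0 \<le> r + p * n"
  proof (rule ccontr)
    assume "\<not> n \<ge> 0"
    hence "p * n \<le> p * (-1)" using assms by (intro mult_left_mono) auto
    thus False using that assms by linarith
  qed
  assume *: "r + p * n < 0"
  have n: "n < 0"
  proof (rule ccontr)
    assume "\<not> n < 0"
    hence "p * n \<ge> 0" using assms by simp
    thus False using * assms by linarith
  qed
  have 1: "s * n - p * n = (p - s) * (- n)" by (simp add: algebra_simps)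
  have 2: "(p - s) * (- n) \<ge> r * (- n)" using n assms by (intro mult_right_mono) auto
  have 3: "r * (- n) \<ge> r * 1" using n assms by (intro mult_left_mono) auto
  have 4: "(p - s) * (- n) \<ge> 1 * (- n)" using n assms by (intro mult_right_mono) auto
  show "n < 0 \<and> s * n - (r + p * n) \<ge> \<bar>n\<bar> - r \<and> s * n - (r + p * n) \<ge> 0"
    using n 1 2 3 4 by linarith
qed

lemma lambert_term_dvd:
  assumes "0 < s" "s < p" "s + r \<le> p"
  shows "fps_X ^ (nat \<bar>n\<bar> - r) dvd lambert_term c s r p n"
proof -
  have "fps_X ^ (nat \<bar>n\<bar> - r) dvd lambert_frac c (int s * n) (int r + int p * n)"
  proof (cases "0 \<le> int r + int p * n")
    case True
    hence n: "n \<ge> 0" using lambert_term_exponents(1)[of "int s" "int p" "int r" n] assms by auto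
    have "1 * n \<le> int s * n" using n assms by (intro mult_right_mono) auto
    thus ?thesis using True n by (intro lambert_frac_dvd) auto
  next
    case False
    thus ?thesis using lambert_term_exponents(2)[of "int s" "int p" "int r" n] assms by (intro lambert_frac_dvd) auto
  qed
  thus ?thesis unfolding lambert_term_def by (rule dvd_mult)
qed

lemma fps_to_fls_lambert_term:
  assumes "0 < s" "s < p" "s + r \<le> p" and c: "c * c = 1" "c = 1 \<Longrightarrow> r > 0"
  shows "fps_to_fls (lambert_term c s r p n) = fls_const (c powi n) * fls_X powi (int s * n) / 
           (1 - fls_const c * fls_X powi (int r + int p * n))"
proof -
  have "fps_to_fls (lambert_frac c (int s * n) (int r + int p * n)) = fls_X powi (int s * n) / 
           (1 - fls_const c * fls_X powi (int r + int p * n))"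
  proof (rule fps_to_fls_lambert_frac)
    have srp: "0 < int s" "int s < int p" "0 \<le> int r" "int s + int r \<le> int p" using assms by auto
    show "c * c = 1" by fact
    show "0 \<le> int r + int p * n \<longrightarrow> 0 \<le> int s * n" 
    proof
      assume "0 \<le> int r + int p * n"
      hence "n \<ge> 0" by (rule lambert_term_exponents(1)[OF srp])
      thus "0 \<le> int s * n" by simp
    qed
    show "int r + int p * n < 0 \<longrightarrow> int r + int p * n \<le> int s * n" 
      using lambert_term_exponents(2)[OF srp, of n] by linarith
    show "int r + int p * n = 0 \<longrightarrow> c \<noteq> 1"
    proof (intro impI notI)
      assume *: "int r + int p * n = 0" "c = 1"
      \<comment> \<open>A vanishing exponent would force p to divide r, impossible since c = 1
        requires r > 0 and s > 0 gives r < p.\<close>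
      have "int r = int p * (- n)" using *(1) by simp
      hence "int p dvd int r" by (rule dvdI)
      hence "p \<le> r" using c(2) * by (auto dest: dvd_imp_le)
      thus False using assms by auto
    qed
  qed
  thus ?thesis by (simp add: lambert_term_def fls_times_fps_to_fls)
qed

lemma fls_X_power_neq_1: "0 < k \<Longrightarrow> fls_const c * fls_X ^ k \<noteq> (1 :: complex fls)"
proof
  assume "0 < k" "fls_const c * fls_X ^ k = (1 :: complex fls)"
  hence "fps_to_fls (cst c * fps_X ^ k) = fps_to_fls 1" by (simp add: fls_times_fps_to_fls fps_to_fls_power)
  hence "(cst c * fps_X ^ k) $ 0 = (1 :: complex fps) $ 0" by (simp only: fps_to_fls_eq_iff)
  thus False using \<open>0 < k\<close> by simp
qed

text \<open>\<open>finite_kronecker\<close> with P = X^p over Laurent series. Every constituent is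
  the image of a power series, so the identity descends by injectivity of
  \<open>fps_to_fls\<close>.\<close>

lemma finite_kronecker_fps:
  assumes srp: "0 < s" "s < p" "s + r \<le> p" and c: "c * c = 1" "c = 1 \<Longrightarrow> r > 0"
  shows "qpart 1 (s + r) p N * qpart 1 (p - s - r) p N * inverse (qpart c r p (Suc N) * qpart c (p - r) p N) =
    (\<Sum>n\<in>{-int N..int N}. lambert_term c s r p n * 
       (qpart c s p (nat (int N - n)) * qpart c (p - s) p (nat (int N + n)) * 
        inverse (qpart 1 p p (nat (int N - n)) * qpart 1 p p (nat (int N + n)))))"
proof -
  define P where "P = (fls_X :: complex fls) ^ p"
  define y where "y = fls_const c * fls_X ^ s"
  define z where "z = fls_const c * fls_X ^ r"
  have cc: "fls_const c * fls_const c = 1" using c(1) by (simp add: fls_const_mult_const)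
  have c0: "c \<noteq> 0" "fls_const c \<noteq> 0" using c(1) by auto
  have P0: "P \<noteq> 0" and y0: "y \<noteq> 0" and z0: "z \<noteq> 0" using c0 by (auto simp: P_def y_def z_def)
  have "z * y = (fls_const c * fls_const c) * fls_X ^ (s + r)" by (simp add: y_def z_def power_add mult_ac)
  hence zy: "z * y = fls_X ^ (s + r)" by (simp add: c(1))
  have div: "fls_X ^ p / (fls_const c * fls_X ^ k) = fls_const c * fls_X ^ (p - k)" if "k \<le> p" for k
  proof -
    have "fls_X ^ p = (fls_X :: complex fls) ^ (p - k) * fls_X ^ k" using that by (simp flip: power_add)
    thus ?thesis using c0 cc by (simp add: divide_simps)
  qed
  have Pzy: "P / (z * y) = fls_X ^ (p - s - r)"
  proof -
    have "P = fls_X ^ (p - s - r) * fls_X ^ (s + r)" using srp unfolding P_def by (simp flip: power_add)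
    hence "P / (z * y) = fls_X ^ (p - s - r) * (z * y) / (z * y)" by (simp only: zy)
    also have "\<dots> = fls_X ^ (p - s - r)" using y0 z0 by (intro nonzero_mult_div_cancel_right) simp
    finally show ?thesis .
  qed
  have Py: "P / y = fls_const c * fls_X ^ (p - s)" and Pz: "P / z = fls_const c * fls_X ^ (p - r)"
    unfolding P_def y_def z_def by (rule div; use srp in simp)+
  have cne: "c \<noteq> 1 \<or> r > 0" using c by auto
  have "fps_to_fls (qpart 1 (s + r) p N * qpart 1 (p - s - r) p N * inverse (qpart c r p (Suc N) * qpart c (p - r) p N)) =
    field_qpoch (z * y) P N * field_qpoch (P / (z * y)) P N / (field_qpoch z P (Suc N) * field_qpoch (P / z) P N)"
    unfolding Pzy Pz unfolding zy
    using srp cne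
    by (subst fps_to_fls_mult_inverse) 
       (auto simp: fls_times_fps_to_fls fps_to_fls_qpart qpart_nth_0 P_def z_def)
  also have "\<dots> = (\<Sum>m\<le>2 * N. y ^ m / y ^ N / (1 - z * P ^ m / P ^ N) * 
            (field_qpoch y P (2 * N - m) * field_qpoch (P / y) P m / (field_qpoch P P (2 * N - m) * field_qpoch P P m)))"
  proof (rule finite_kronecker)
    show "P ^ k \<noteq> 1" if "0 < k" for k
      using fls_X_power_neq_1[of "p * k" 1] that srp by (simp add: P_def power_mult)
    show "z * P ^ k \<noteq> 1" if "k \<le> N" for k
    proof (cases "r + p * k = 0")
      case True
      thus ?thesis using cne srp fls_const_nonzero by (auto simp: z_def)
    next
      case False
      thus ?thesis using fls_X_power_neq_1[of "r + p * k" c] by (simp add: z_def P_def power_add power_mult mult.assoc)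
    qed
    show "P ^ k \<noteq> z" if "0 < k" for k
    proof
      assume "P ^ k = z"
      hence "P ^ k / z = 1" using z0 by simp
      moreover have "P ^ k / z = P / z * P ^ (k - 1)" using that P0 z0 by (simp add: power_eq_if)
      ultimately have "fls_const c * fls_X ^ (p - r + p * (k - 1)) = 1" 
        unfolding Pz by (simp add: P_def power_add power_mult mult_ac)
      thus False using fls_X_power_neq_1[of "p - r + p * (k - 1)" c] srp by auto
    qed
  qed (use P0 y0 z0 in auto)
  also have "\<dots> = (\<Sum>n\<in>{-int N..int N}. fps_to_fls (lambert_term c s r p n * 
       (qpart c s p (nat (int N - n)) * qpart c (p - s) p (nat (int N + n)) * 
        inverse (qpart 1 p p (nat (int N - n)) * qpart 1 p p (nat (int N + n))))))"
  proof (rule sum.reindex_bij_witness[of _ "\<lambda>n. nat (int N + n)" "\<lambda>m. int m - int N"])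
    fix m assume m: "m \<in> {..2 * N}"
    define n where "n = int m - int N"
    have mn: "nat (int N + n) = m" "nat (int N - n) = 2 * N - m" using m by (auto simp: n_def)
    have yn: "y ^ m / y ^ N = fls_const (c powi n) * fls_X powi (int s * n)"
    proof -
      have "y ^ m / y ^ N = y powi n" using y0 by (simp add: n_def power_int_diff)
      also have "\<dots> = fls_const c powi n * fls_X powi (int s * n)"
        by (simp add: y_def power_int_mult_distrib power_int_mult)
      also have "fls_const c powi n = fls_const (c powi n)"
        by (cases "n \<ge> 0") (auto simp: power_int_def fls_const_power fls_inverse_const)
      finally show ?thesis .
    qed
    have zn: "z * P ^ m / P ^ N = fls_const c * fls_X powi (int r + int p * n)"
    proof -
      have "P ^ m / P ^ N = P powi n" using P0 by (simp add: n_def power_int_diff)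
      also have "\<dots> = fls_X powi (int p * n)" by (simp add: P_def power_int_mult)
      finally show ?thesis
        by (simp only: z_def power_int_add[OF disjI1[OF fls_X_neq_0]] power_int_of_nat mult.assoc times_divide_eq_right[symmetric])
    qed
    show "fps_to_fls (lambert_term c s r p (int m - int N) * 
       (qpart c s p (nat (int N - (int m - int N))) * qpart c (p - s) p (nat (int N + (int m - int N))) * 
        inverse (qpart 1 p p (nat (int N - (int m - int N))) * qpart 1 p p (nat (int N + (int m - int N)))))) = 
      y ^ m / y ^ N / (1 - z * P ^ m / P ^ N) * 
            (field_qpoch y P (2 * N - m) * field_qpoch (P / y) P m / (field_qpoch P P (2 * N - m) * field_qpoch P P m))"
      unfolding n_def[symmetric] mn yn zn Py using srp c
      by (subst fls_times_fps_to_fls, subst fps_to_fls_mult_inverse)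
         (auto simp: fps_to_fls_lambert_term fls_times_fps_to_fls fps_to_fls_qpart qpart_nth_0 P_def y_def)
  qed auto
  finally show ?thesis unfolding fps_to_fls_sum[symmetric] by (simp only: fps_to_fls_eq_iff)
qed

text \<open>Let N grow in the finite identity. In the term with index n the quotient of truncated
  products agrees with its limit R only modulo X^(N - |n|), but the term itself is divisible by
  X^(|n| - r). All errors are thus of order N - r uniformly in n, and R can be pulled out of the sum
  and divided away.\<close>

lemma kronecker_fps:
  assumes srp: "0 < s" "s < p" "s + r \<le> p" and c: "c * c = 1" "c = 1 \<Longrightarrow> r > 0"
  shows "(lambert_term c s r p has_sum 
            (qp p p)\<^sup>2 * qp (s + r) p * qp (p - s - r) p *
            inverse (qpoch c r p * qpoch c (p - r) p * qpoch c s p * qpoch c (p - s) p)) UNIV"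
proof (rule has_sum_int_fcongI[where r = r])
  fix N
  define R where "R = qpoch c s p * qpoch c (p - s) p * inverse (qp p p * qp p p)"
  define L where "L = qp (s + r) p * qp (p - s - r) p * inverse (qpoch c r p * qpoch c (p - r) p)"
  have nz: "qpoch c s p $ 0 \<noteq> 0" "qpoch c (p - s) p $ 0 \<noteq> 0" "qp p p $ 0 \<noteq> 0" 
           "qpoch c r p $ 0 \<noteq> 0" "qpoch c (p - r) p $ 0 \<noteq> 0"
  proof -
    have "c \<noteq> 1 \<or> r > 0" using c by auto
    thus "qpoch c s p $ 0 \<noteq> 0" "qpoch c (p - s) p $ 0 \<noteq> 0" "qp p p $ 0 \<noteq> 0" 
           "qpoch c r p $ 0 \<noteq> 0" "qpoch c (p - r) p $ 0 \<noteq> 0"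
      using srp by (auto simp: qpoch_nth_0_nonzero)
  qed
  have "fcong (N - r) (L) (qpart 1 (s + r) p N * qpart 1 (p - s - r) p N * inverse (qpart c r p (Suc N) * qpart c (p - r) p N))"
  proof -
    have le: "N - r \<le> j + p * N" "N - r \<le> j + p * Suc N" for j
      using le_add_mult[of p N j] srp by auto
    have "c \<noteq> 1 \<or> r > 0" using c by auto
    hence nz': "(qpoch c r p * qpoch c (p - r) p) $ 0 \<noteq> 0" "(qpart c r p (Suc N) * qpart c (p - r) p N) $ 0 \<noteq> 0"
      using srp nz by (auto simp: qpart_nth_0)
    show ?thesis
      unfolding L_def using srp nz' by (intro fcong_mult fcong_inverse qpoch_fcong le) auto
  qed
  also note finite_kronecker_fps[OF srp c]
  also have "fcong (N - r) (\<Sum>n\<in>{-int N..int N}. lambert_term c s r p n * 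
       (qpart c s p (nat (int N - n)) * qpart c (p - s) p (nat (int N + n)) * 
        inverse (qpart 1 p p (nat (int N - n)) * qpart 1 p p (nat (int N + n))))) (\<Sum>n\<in>{-int N..int N}. lambert_term c s r p n * R)"
  proof (rule fcong_sum)
    fix n assume n: "n \<in> {-int N..int N}"
    obtain u where u: "lambert_term c s r p n = fps_X ^ (nat \<bar>n\<bar> - r) * u"
      using lambert_term_dvd[OF srp] unfolding dvd_def by blast
    have le: "N - nat \<bar>n\<bar> \<le> nat (int N - n)" "N - nat \<bar>n\<bar> \<le> nat (int N + n)" using n by auto
    have le': "j \<ge> 0 \<Longrightarrow> N - nat \<bar>n\<bar> \<le> j + p * nat (int N - n)" "N - nat \<bar>n\<bar> \<le> j + p * nat (int N + n)" for j :: nat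
      using le mult_le_mono1[of 1 p "nat (int N - n)"] mult_le_mono1[of 1 p "nat (int N + n)"] srp by linarith+
    have "fcong (N - nat \<bar>n\<bar>) R 
       (qpart c s p (nat (int N - n)) * qpart c (p - s) p (nat (int N + n)) * 
        inverse (qpart 1 p p (nat (int N - n)) * qpart 1 p p (nat (int N + n))))"
      unfolding R_def using srp nz c
      by (intro fcong_mult fcong_inverse qpoch_fcong le') (auto simp: qpart_nth_0)
    hence "fcong (N - nat \<bar>n\<bar>) (u * 
       (qpart c s p (nat (int N - n)) * qpart c (p - s) p (nat (int N + n)) * 
        inverse (qpart 1 p p (nat (int N - n)) * qpart 1 p p (nat (int N + n))))) (u * R)"
      by (intro fcong_mult[OF fcong_refl]) (rule fcong_sym)
    from fcong_mult_left[OF this, of "nat \<bar>n\<bar> - r"] show "fcong (N - r) (lambert_term c s r p n * 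
       (qpart c s p (nat (int N - n)) * qpart c (p - s) p (nat (int N + n)) * 
        inverse (qpart 1 p p (nat (int N - n)) * qpart 1 p p (nat (int N + n))))) (lambert_term c s r p n * R)"
      unfolding u mult.assoc by (rule fcong_mono) (use n in auto)
  qed
  finally have "fcong (N - r) ((\<Sum>n\<in>{-int N..int N}. lambert_term c s r p n) * R) L"
    by (simp add: sum_distrib_right fcong_sym)
  hence "fcong (N - r) ((\<Sum>n\<in>{-int N..int N}. lambert_term c s r p n) * R * inverse R) (L * inverse R)"
    by (rule fcong_mult) auto
  moreover have "R $ 0 \<noteq> 0" unfolding R_def using nz by simp
  hence "R * inverse R = 1" by (simp add: inverse_mult_eq_1')
  moreover have "L * inverse R = (qp p p)\<^sup>2 * qp (s + r) p * qp (p - s - r) p *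
            inverse (qpoch c r p * qpoch c (p - r) p * qpoch c s p * qpoch c (p - s) p)"
    using nz by (simp add: L_def R_def fps_inverse_mult power2_eq_square mult_ac)
  ultimately show "fcong (N - r) (sum (lambert_term c s r p) {-int N..int N}) ((qp p p)\<^sup>2 * qp (s + r) p * qp (p - s - r) p *
            inverse (qpoch c r p * qpoch c (p - r) p * qpoch c s p * qpoch c (p - s) p))"
    by (simp add: mult.assoc)
qed (rule lambert_term_dvd[OF srp])

section \<open>The series K(z) as a quotient of products\<close>

definition rank_term :: "complex \<Rightarrow> nat \<Rightarrow> complex fps" where
  "rank_term z n = cst ((1 - z) * (1 - inverse z) * (-1) ^ n) * fps_X ^ n *
      inverse ((1 - cst z * fps_X ^ n) * (1 - cst (inverse z) * fps_X ^ n))"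

lemma quadratic_factor:
  fixes a b t :: "'a::comm_ring_1"
  assumes "a * b = 1"
  shows "1 - (a + b) * t + t\<^sup>2 = (1 - a * t) * (1 - b * t)"
    and "1 + (a + b) * t + t\<^sup>2 = (1 + a * t) * (1 + b * t)"
proof -
  have "a * t * (b * t) = (a * b) * t\<^sup>2" by (simp add: power2_eq_square mult_ac)
  hence "a * t * (b * t) = t\<^sup>2" using assms by simp
  thus "1 - (a + b) * t + t\<^sup>2 = (1 - a * t) * (1 - b * t)" "1 + (a + b) * t + t\<^sup>2 = (1 + a * t) * (1 + b * t)"
    by (simp_all add: distrib_right distrib_left left_diff_distrib right_diff_distrib)
qed

text \<open>Taking x = z + 1/z and P = X, both quadratics split into linear factors in z and 1/z,
  and 2 - x becomes (1 - z)(1 - 1/z).\<close>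

lemma finite_reciprocal_theta_quotient_fps:
  assumes z: "z \<noteq> 0"
  shows "qpart (- z) 1 1 N * qpart (- inverse z) 1 1 N * inverse (qpart z 1 1 N * qpart (inverse z) 1 1 N) =
    (qpart (-1) 1 1 N)\<^sup>2 * inverse ((qpart 1 1 1 N)\<^sup>2) +
    (\<Sum>i\<in>{1..N}. 2 * rank_term z i * 
       (qpart (-1) 1 1 (N - i) * qpart (-1) 1 1 (N + i) * inverse (qpart 1 1 1 (N - i) * qpart 1 1 1 (N + i))))"
proof -
  define P where "P = (fls_X :: complex fls)"
  define x where "x = fls_const (z + inverse z)"
  have zz: "fls_const z * fls_const (inverse z) = 1" using z by (simp add: fls_const_mult_const)
  have x: "x = fls_const z + fls_const (inverse z)" by (simp add: x_def fls_plus_const)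
  have m: "1 - x * P ^ k + (P ^ k)\<^sup>2 = (1 - fls_const z * P ^ k) * (1 - fls_const (inverse z) * P ^ k)"
          "1 + x * P ^ k + (P ^ k)\<^sup>2 = (1 + fls_const z * P ^ k) * (1 + fls_const (inverse z) * P ^ k)" for k
  proof -
    show "1 - x * P ^ k + (P ^ k)\<^sup>2 = (1 - fls_const z * P ^ k) * (1 - fls_const (inverse z) * P ^ k)"
      using quadratic_factor(1)[OF zz] unfolding x .
    show "1 + x * P ^ k + (P ^ k)\<^sup>2 = (1 + fls_const z * P ^ k) * (1 + fls_const (inverse z) * P ^ k)"
      using quadratic_factor(2)[OF zz] unfolding x .
  qed
  have q: "fps_to_fls (qpart c 1 1 N) = (\<Prod>k\<in>{1..N}. 1 - fls_const c * P ^ k)" for c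
    unfolding fps_to_fls_qpart field_qpoch_def P_def
    by (rule prod.reindex_bij_witness[of _ "\<lambda>k. k - 1" Suc]) (auto simp: mult_ac)
  have q': "fps_to_fls (qpart 1 1 1 N) = field_qpoch P P N" "fps_to_fls (qpart (-1) 1 1 N) = field_qpoch (-P) P N" for N
    by (auto simp: fps_to_fls_qpart P_def)
  have nz [simp]: "qpart c 1 1 n $ 0 \<noteq> 0" for c n by (simp add: qpart_nth_0)
  have "fps_to_fls (qpart (- z) 1 1 N * qpart (- inverse z) 1 1 N * inverse (qpart z 1 1 N * qpart (inverse z) 1 1 N)) = 
        (\<Prod>k\<in>{1..N}. (1 + x * P ^ k + (P ^ k)\<^sup>2) / (1 - x * P ^ k + (P ^ k)\<^sup>2))"
    by (subst fps_to_fls_mult_inverse) (simp_all add: fls_times_fps_to_fls q m prod_dividef prod.distrib del: One_nat_def)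
  also have "\<dots> = (field_qpoch (- P) P N / field_qpoch P P N)\<^sup>2 +
         (\<Sum>i\<in>{1..N}. 2 * (- 1) ^ i * P ^ i * (2 - x) / (1 - x * P ^ i + (P ^ i)\<^sup>2) *
            (field_qpoch (- P) P (N - i) * field_qpoch (- P) P (N + i) / (field_qpoch P P (N - i) * field_qpoch P P (N + i))))"
  proof (rule finite_reciprocal_theta_quotient)
    show "P ^ k \<noteq> 1" if "0 < k" for k using fls_X_power_neq_1[of k 1] that by (simp add: P_def)
    show "1 - x * P ^ k + (P ^ k)\<^sup>2 \<noteq> 0" if "0 < k" for k
      unfolding m using fls_X_power_neq_1[of k z] fls_X_power_neq_1[of k "inverse z"] that by (simp add: P_def)
  qed (simp add: P_def)
  also have "(field_qpoch (- P) P N / field_qpoch P P N)\<^sup>2 = fps_to_fls ((qpart (-1) 1 1 N)\<^sup>2 * inverse ((qpart 1 1 1 N)\<^sup>2))"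
    by (subst fps_to_fls_mult_inverse) (simp_all add: fps_to_fls_power q' power_divide fps_power_zeroth del: One_nat_def)
  also have "(\<Sum>i\<in>{1..N}. 2 * (- 1) ^ i * P ^ i * (2 - x) / (1 - x * P ^ i + (P ^ i)\<^sup>2) *
            (field_qpoch (- P) P (N - i) * field_qpoch (- P) P (N + i) / (field_qpoch P P (N - i) * field_qpoch P P (N + i)))) = 
     (\<Sum>i\<in>{1..N}. fps_to_fls (2 * rank_term z i * 
       (qpart (-1) 1 1 (N - i) * qpart (-1) 1 1 (N + i) * inverse (qpart 1 1 1 (N - i) * qpart 1 1 1 (N + i)))))"
  proof (rule sum.cong)
    fix i assume i: "i \<in> {1..N}"
    have "((1 - cst z * fps_X ^ i) * (1 - cst (inverse z) * fps_X ^ i)) $ 0 \<noteq> 0"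
      using i by simp
    hence "fps_to_fls (rank_term z i) = fls_const ((1 - z) * (1 - inverse z) * (-1) ^ i) * P ^ i / (1 - x * P ^ i + (P ^ i)\<^sup>2)"
      unfolding m rank_term_def 
      by (subst fps_to_fls_mult_inverse) (simp_all add: fls_times_fps_to_fls fps_to_fls_power P_def)
    moreover have "fls_const ((1 - z) * (1 - inverse z) * (-1) ^ i) = (2 - x) * (-1) ^ i"
    proof -
      have "(1 - z) * (1 - inverse z) = 2 - (z + inverse z)" using z by (simp add: algebra_simps)
      hence "fls_const ((1 - z) * (1 - inverse z) * (-1) ^ i) = fls_const (2 - (z + inverse z)) * fls_const ((-1) ^ i)"
        by (simp add: fls_const_mult_const)
      also have "fls_const ((-1 :: complex) ^ i) = (-1) ^ i" by (cases "even i") auto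
      also have "fls_const (2 - (z + inverse z)) = 2 - x"
        unfolding x_def by (metis fls_minus_const fls_const_numeral)
      finally show ?thesis .
    qed
    ultimately have ct: "fps_to_fls (rank_term z i) = (2 - x) * (-1) ^ i * P ^ i / (1 - x * P ^ i + (P ^ i)\<^sup>2)" by simp
    have r: "fps_to_fls (qpart (-1) 1 1 (N - i) * qpart (-1) 1 1 (N + i) * inverse (qpart 1 1 1 (N - i) * qpart 1 1 1 (N + i))) = 
       field_qpoch (- P) P (N - i) * field_qpoch (- P) P (N + i) / (field_qpoch P P (N - i) * field_qpoch P P (N + i))"
      by (subst fps_to_fls_mult_inverse) (simp_all add: fls_times_fps_to_fls q' del: One_nat_def)
    show "2 * (- 1) ^ i * P ^ i * (2 - x) / (1 - x * P ^ i + (P ^ i)\<^sup>2) *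
            (field_qpoch (- P) P (N - i) * field_qpoch (- P) P (N + i) / (field_qpoch P P (N - i) * field_qpoch P P (N + i))) = 
      fps_to_fls (2 * rank_term z i * 
       (qpart (-1) 1 1 (N - i) * qpart (-1) 1 1 (N + i) * inverse (qpart 1 1 1 (N - i) * qpart 1 1 1 (N + i))))"
      unfolding fls_times_fps_to_fls[of "2 * rank_term z i"] r 
      unfolding fls_times_fps_to_fls ct by (simp add: mult_ac)
  qed auto
  finally show ?thesis 
    unfolding fps_to_fls_sum[symmetric] fps_to_fls_plus[symmetric] by (simp only: fps_to_fls_eq_iff)
qed

text \<open>Same limit argument as for Kronecker's series: summand i has order at least i, which
  offsets precision N - i of its cofactor. The limit reads (1 + 2 times the sum) R = L, so the sum
  is (L/R - 1)/2; adding 1/2 gives K(z).\<close>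

lemma rank_sums:
  assumes z: "z \<noteq> 0"
  shows "(\<lambda>n. rank_term z (n + 1)) sums
     (cst (1/2) * ((qp 1 1)\<^sup>2 * qpoch (- z) 1 1 * qpoch (- inverse z) 1 1 *
       inverse ((qpoch (-1) 1 1)\<^sup>2 * qpoch z 1 1 * qpoch (inverse z) 1 1)) - cst (1/2))"
proof -
  define R where "R = (qpoch (-1) 1 1)\<^sup>2 * inverse ((qp 1 1)\<^sup>2)"
  define L where "L = qpoch (- z) 1 1 * qpoch (- inverse z) 1 1 * inverse (qpoch z 1 1 * qpoch (inverse z) 1 1)"
  have nz: "qpart c 1 1 n $ 0 \<noteq> 0" "qpoch c 1 1 $ 0 = 1" for c n 
    by (simp_all add: qpart_nth_0 qpoch_nth_0)
  note [simp] = nz nz[unfolded One_nat_def]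
  have main: "fcong N (\<Sum>i\<in>{1..N}. rank_term z i) (cst (1/2) * (L * inverse R) - cst (1/2))" for N
  proof -
    have "fcong N L (qpart (- z) 1 1 N * qpart (- inverse z) 1 1 N * inverse (qpart z 1 1 N * qpart (inverse z) 1 1 N))"
      unfolding L_def by (intro fcong_mult fcong_inverse qpoch_fcong') auto
    also note finite_reciprocal_theta_quotient_fps[OF z]
    also have "fcong N ((qpart (-1) 1 1 N)\<^sup>2 * inverse ((qpart 1 1 1 N)\<^sup>2) +
    (\<Sum>i\<in>{1..N}. 2 * rank_term z i * 
       (qpart (-1) 1 1 (N - i) * qpart (-1) 1 1 (N + i) * inverse (qpart 1 1 1 (N - i) * qpart 1 1 1 (N + i)))))
       (R + (\<Sum>i\<in>{1..N}. 2 * rank_term z i * R))"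
    proof (intro fcong_add fcong_sum)
      show "fcong N ((qpart (- 1) 1 1 N)\<^sup>2 * inverse ((qpart 1 1 1 N)\<^sup>2)) R"
        unfolding R_def by (rule fcong_sym, intro fcong_mult fcong_inverse fcong_power qpoch_fcong') (auto simp: fps_power_zeroth)
      fix i assume i: "i \<in> {1..N}"
      define u where "u = 2 * cst ((1 - z) * (1 - inverse z) * (-1) ^ i) * 
        inverse ((1 - cst z * fps_X ^ i) * (1 - cst (inverse z) * fps_X ^ i))"
      have u: "2 * rank_term z i = fps_X ^ i * u"
        by (simp add: rank_term_def u_def mult_ac)
      have "fcong (N - i) R 
       (qpart (-1) 1 1 (N - i) * qpart (-1) 1 1 (N + i) * inverse (qpart 1 1 1 (N - i) * qpart 1 1 1 (N + i)))"
        unfolding R_def power2_eq_square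
        by (intro fcong_mult fcong_inverse qpoch_fcong) auto
      hence "fcong (N - i) (u * 
       (qpart (-1) 1 1 (N - i) * qpart (-1) 1 1 (N + i) * inverse (qpart 1 1 1 (N - i) * qpart 1 1 1 (N + i)))) (u * R)"
        by (intro fcong_mult[OF fcong_refl]) (rule fcong_sym)
      from fcong_mult_left[OF this, of i] show "fcong N (2 * rank_term z i * 
       (qpart (-1) 1 1 (N - i) * qpart (-1) 1 1 (N + i) * inverse (qpart 1 1 1 (N - i) * qpart 1 1 1 (N + i)))) (2 * rank_term z i * R)"
        unfolding u mult.assoc using i by simp
    qed
    finally have "fcong N ((1 + 2 * (\<Sum>i\<in>{1..N}. rank_term z i)) * R) L"
      by (simp add: sum_distrib_right sum_distrib_left algebra_simps fcong_sym)
    hence "fcong N ((1 + 2 * (\<Sum>i\<in>{1..N}. rank_term z i)) * R * inverse R) (L * inverse R)"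
      by (rule fcong_mult) auto
    moreover have "R * inverse R = 1" unfolding R_def by (simp add: inverse_mult_eq_1' fps_power_zeroth)
    ultimately have "fcong N (1 + 2 * (\<Sum>i\<in>{1..N}. rank_term z i)) (L * inverse R)"
      by (simp add: mult.assoc)
    hence "fcong N (cst (1/2) * (1 + 2 * (\<Sum>i\<in>{1..N}. rank_term z i)) + - cst (1/2)) (cst (1/2) * (L * inverse R) + - cst (1/2))"
      by (intro fcong_add fcong_mult) auto
    also have "cst (1/2) * (1 + 2 * S) + - cst (1/2) = S" for S
    proof -
      have "cst (1/2) * 2 = 1" by (simp add: numeral_fps_const)
      thus ?thesis by algebra
    qed
    finally show ?thesis by (simp only: add_uminus_conv_diff)
  qed
  have "(\<lambda>n. rank_term z (n + 1)) sums (cst (1/2) * (L * inverse R) - cst (1/2))"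
    unfolding sums_def
  proof (rule tendsto_fpsI)
    fix k
    have "(\<Sum>n<N. rank_term z (n + 1)) = (\<Sum>i\<in>{1..N}. rank_term z i)" for N
      by (rule sum.reindex_bij_witness[of _ "\<lambda>k. k - 1" Suc]) auto
    hence *: "(\<Sum>n<N. rank_term z (n + 1)) $ k = (cst (1/2) * (L * inverse R) - cst (1/2)) $ k" if "N > k" for N
      using fcong_nth[OF main[of N] that] by simp
    show "\<forall>\<^sub>F N in sequentially. (\<Sum>n<N. rank_term z (n + 1)) $ k = (cst (1/2) * (L * inverse R) - cst (1/2)) $ k"
      by (rule eventually_mono[OF eventually_gt_at_top[of k]]) (rule *)
  qed
  moreover have "L * inverse R = (qp 1 1)\<^sup>2 * qpoch (- z) 1 1 * qpoch (- inverse z) 1 1 *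
       inverse ((qpoch (-1) 1 1)\<^sup>2 * qpoch z 1 1 * qpoch (inverse z) 1 1)"
    by (simp add: L_def R_def fps_inverse_mult mult_ac fps_power_zeroth)
  ultimately show ?thesis by simp
qed

subsection \<open>Dissections\<close>

lemma qpoch_compose:
  assumes "d > 0" "m > 0"
  shows "qpoch c j d oo fps_X ^ m = qpoch c (m * j) (m * d)"
proof (rule fcong_eqI[of 0 0])
  fix N
  have m0: "(fps_X ^ m :: complex fps) $ 0 = 0" using assms by simp
  have *: "(1 - cst c * fps_X ^ k) oo fps_X ^ m = 1 - cst c * fps_X ^ (m * k)" for k
    using m0 assms by (simp add: fps_compose_sub_distrib fps_compose_mult_distrib fps_X_power_compose flip: power_mult)
  have "qpart c j d N oo fps_X ^ m = qpart c (m * j) (m * d) N"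
    unfolding qpart_def by (simp add: fps_compose_prod_distrib[OF m0] * distrib_left mult.assoc)
  hence "fcong N (qpoch c j d oo fps_X ^ m) (qpart c (m * j) (m * d) N)"
    using fcong_compose[OF qpoch_fcong'[OF assms(1)] assms(2)] by metis
  also have "fcong N \<dots> (qpoch c (m * j) (m * d))"
    using assms by (intro fcong_sym[OF qpoch_fcong']) auto
  finally show "fcong (N - 0) (qpoch c j d oo fps_X ^ m) (qpoch c (m * j) (m * d))" by simp
qed

lemma qpart_residues:
  "qpart c j d (m * N) = (\<Prod>i<m. qpart c (j + i * d) (m * d) N)"
proof (induction N)
  case (Suc N)
  have "qpart c j d (m * Suc N) = qpart c j d (m * N) * (\<Prod>i<m. 1 - cst c * fps_X ^ (j + d * (m * N + i)))"
    unfolding qpart_def using prod_lessThan_split[of "m * N" "m * Suc N"] by simp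
  moreover have "j + d * (m * N + i) = j + i * d + m * d * N" for i by (simp add: algebra_simps)
  ultimately show ?case unfolding Suc by (simp add: qpart_def prod.distrib)
qed (simp add: qpart_def)

lemma qpoch_residues:
  assumes "d > 0" "m > 0"
  shows "qpoch c j d = (\<Prod>i<m. qpoch c (j + i * d) (m * d))"
proof (rule fcong_eqI[of 0 0])
  fix N
  have "N \<le> j + d * (m * N)" using le_add_mult[of "d * m" N j] assms by (simp add: mult_ac)
  hence "fcong N (qpoch c j d) (qpart c j d (m * N))"
    using assms by (intro qpoch_fcong) 
  also have "fcong N \<dots> (\<Prod>i<m. qpoch c (j + i * d) (m * d))"
    unfolding qpart_residues using assms by (intro fcong_prod fcong_sym[OF qpoch_fcong']) auto
  finally show "fcong (N - 0) (qpoch c j d) (\<Prod>i<m. qpoch c (j + i * d) (m * d))" by simp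
qed

text \<open>Factorwise (1 - c t)(1 + c t) = 1 - c^2 t^2. For c = 1 this expresses products with
  argument -q^j by products with positive sign in doubled base.\<close>

lemma qpoch_mult_uminus:
  assumes "d > 0"
  shows "qpoch c j d * qpoch (- c) j d = qpoch (c\<^sup>2) (2 * j) (2 * d)"
proof (rule fcong_eqI[of 0 0])
  fix N
  have A: "qpart c j d N * qpart (- c) j d N = qpart (c\<^sup>2) (2 * j) (2 * d) N"
  proof -
    have *: "(1 - cst c * t) * (1 - cst (- c) * t) = 1 - cst (c\<^sup>2) * t\<^sup>2" for t
      by (simp add: algebra_simps power2_eq_square flip: fps_const_mult fps_const_neg)
    have e: "((fps_X :: complex fps) ^ (j + d * k))\<^sup>2 = fps_X ^ (2 * j + 2 * d * k)" for k
      unfolding power_mult[symmetric] by (rule arg_cong[where f = "\<lambda>n. fps_X ^ n"]) simp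
    show ?thesis by (simp only: qpart_def prod.distrib[symmetric] * e)
  qed
  have B: "fcong N (qpoch c j d * qpoch (- c) j d) (qpart c j d N * qpart (- c) j d N)"
    using assms by (intro fcong_mult qpoch_fcong')
  have C: "fcong N (qpart (c\<^sup>2) (2 * j) (2 * d) N) (qpoch (c\<^sup>2) (2 * j) (2 * d))"
    using assms by (intro fcong_sym[OF qpoch_fcong']) auto
  show "fcong (N - 0) (qpoch c j d * qpoch (- c) j d) (qpoch (c\<^sup>2) (2 * j) (2 * d))"
    using fcong_trans[OF B[unfolded A] C] by simp
qed

lemma fifth_root_inverse:
  fixes z :: complex
  assumes "z ^ 5 = 1"
  shows "inverse z = z ^ 4" "inverse (z\<^sup>2) = z ^ 3"
proof -
  have "z \<noteq> 0" using assms by auto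
  thus "inverse z = z ^ 4" "inverse (z\<^sup>2) = z ^ 3"
    using assms by (auto intro!: inverse_unique simp flip: power_Suc power_add)
qed

lemma fifth_root_sum:
  fixes z :: complex
  assumes "z ^ 5 = 1" "z \<noteq> 1"
  shows "1 + z + z ^ 2 + z ^ 3 + z ^ 4 = 0"
proof -
  have "(z - 1) * (1 + z + z ^ 2 + z ^ 3 + z ^ 4) = z ^ 5 - 1" by algebra
  thus ?thesis using assms by simp
qed

text \<open>Factorwise this is the splitting of 1 - (c t)^5 over the fifth roots of unity. Inverse
  roots are paired into quadratics with middle coefficients a = z + 1/z and b = z^2 + z^(-2), for
  which a + b = a b = -1.\<close>

lemma qpoch_fifth_roots:
  assumes z: "z ^ 5 = 1" "z \<noteq> 1"
  shows "qpoch c 1 1 * (qpoch (c * z) 1 1 * qpoch (c * inverse z) 1 1) * 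
           (qpoch (c * z\<^sup>2) 1 1 * qpoch (c * inverse (z\<^sup>2)) 1 1) = qpoch (c ^ 5) 5 5"
proof (rule fcong_eqI[of 0 0])
  fix N
  have z0: "z \<noteq> 0" using z by auto
  have inv: "z * inverse z = 1" "z\<^sup>2 * inverse (z\<^sup>2) = 1" using z0 by auto
  note s = fifth_root_sum[OF z]
  note iz = fifth_root_inverse[OF z(1)]
  have fac: "(1 - cst c * t) * ((1 - cst (c * z) * t) * (1 - cst (c * inverse z) * t)) * 
          ((1 - cst (c * z\<^sup>2) * t) * (1 - cst (c * inverse (z\<^sup>2)) * t)) = 1 - cst (c ^ 5) * t ^ 5" for t
  proof -
    define u where "u = cst c * t"
    define a where "a = cst z + cst (inverse z)"
    define b where "b = cst (z\<^sup>2) + cst (inverse (z\<^sup>2))"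
    have "z + inverse z + (z\<^sup>2 + inverse (z\<^sup>2)) = -1" unfolding iz using s by algebra
    hence ab1: "a + b = -1" 
      unfolding a_def b_def fps_const_add by (simp flip: fps_const_neg)
    have "(z + inverse z) * (z\<^sup>2 + inverse (z\<^sup>2)) = -1" unfolding iz using s z(1) by algebra
    hence ab2: "a * b = -1" 
      unfolding a_def b_def fps_const_add fps_const_mult by (simp flip: fps_const_neg)
    have f: "(1 - cst (c * v) * t) * (1 - cst (c * inverse v) * t) = 1 - (cst v + cst (inverse v)) * u + u\<^sup>2" 
      if "v * inverse v = 1" for v
    proof -
      have "cst v * cst (inverse v) = 1" using that by simp
      from quadratic_factor(1)[OF this, of u] show ?thesis
        by (simp add: u_def mult_ac flip: fps_const_mult)
    qed
    have "(1 - u) * (1 - a * u + u\<^sup>2) * (1 - b * u + u\<^sup>2) = 1 - u ^ 5"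
      using ab1 ab2 by algebra
    thus ?thesis unfolding f[OF inv(1)] f[OF inv(2)] a_def[symmetric] b_def[symmetric]
      by (simp add: u_def power_mult_distrib)
  qed
  have A: "qpart c 1 1 N * (qpart (c * z) 1 1 N * qpart (c * inverse z) 1 1 N) * 
           (qpart (c * z\<^sup>2) 1 1 N * qpart (c * inverse (z\<^sup>2)) 1 1 N) = qpart (c ^ 5) 5 5 N"
  proof -
    have e: "((fps_X :: complex fps) ^ (1 + 1 * k)) ^ 5 = fps_X ^ (5 + 5 * k)" for k
      unfolding power_mult[symmetric] by (rule arg_cong[where f = "\<lambda>n. fps_X ^ n"]) simp
    show ?thesis by (simp only: qpart_def prod.distrib[symmetric] fac e)
  qed
  have B: "fcong N (qpoch c 1 1 * (qpoch (c * z) 1 1 * qpoch (c * inverse z) 1 1) * 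
           (qpoch (c * z\<^sup>2) 1 1 * qpoch (c * inverse (z\<^sup>2)) 1 1)) 
     (qpart c 1 1 N * (qpart (c * z) 1 1 N * qpart (c * inverse z) 1 1 N) * 
           (qpart (c * z\<^sup>2) 1 1 N * qpart (c * inverse (z\<^sup>2)) 1 1 N))"
    by (intro fcong_mult qpoch_fcong') auto
  have C: "fcong N (qpart (c ^ 5) 5 5 N) (qpoch (c ^ 5) 5 5)"
    by (intro fcong_sym[OF qpoch_fcong']) auto
  show "fcong (N - 0) (qpoch c 1 1 * (qpoch (c * z) 1 1 * qpoch (c * inverse z) 1 1) * 
           (qpoch (c * z\<^sup>2) 1 1 * qpoch (c * inverse (z\<^sup>2)) 1 1)) (qpoch (c ^ 5) 5 5)"
    using fcong_trans[OF B[unfolded A] C] by simp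
qed

section \<open>Rearranging bilateral sums and substituting powers of X\<close>

lemma has_sum_int_residues:
  fixes f :: "int \<Rightarrow> 'a::topological_comm_monoid_add"
  assumes m: "m > 0" and f: "\<And>i. i < m \<Longrightarrow> ((\<lambda>k. f (int m * k + int i)) has_sum g i) UNIV"
  shows "(f has_sum (\<Sum>i<m. g i)) UNIV"
proof -
  define R where "R i = range (\<lambda>k. int m * k + int i)" for i
  have R: "(f has_sum g i) (R i)" if "i < m" for i
  proof -
    have "inj (\<lambda>k. int m * k + int i)" using m by (auto intro!: injI)
    from has_sum_reindex[OF this, of f "g i"] f[OF that] show ?thesis by (simp add: o_def R_def)
  qed
  have R_eq: "R i = {n. n mod int m = int i}" if "i < m" for i
  proof -
    have "n \<in> R i" if "n mod int m = int i" for n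
    proof -
      have "n = int m * (n div int m) + int i" using that by (metis mult_div_mod_eq)
      thus ?thesis unfolding R_def by blast
    qed
    thus ?thesis using that by (auto simp: R_def)
  qed
  have "j \<le> m \<Longrightarrow> (f has_sum (\<Sum>i<j. g i)) {n. n mod int m < int j}" for j
  proof (induction j)
    case 0
    have "{n. n mod int m < int 0} = {}" using m by (auto simp: not_less)
    thus ?case by simp
  next
    case (Suc j)
    have "{n. n mod int m < int (Suc j)} = {n. n mod int m < int j} \<union> R j"
      using Suc.prems by (auto simp: R_eq)
    moreover have "(f has_sum ((\<Sum>i<j. g i) + g j)) ({n. n mod int m < int j} \<union> R j)"
      using Suc R[of j] by (intro has_sum_Un_disjoint) (auto simp: R_eq)
    ultimately show ?case by simp
  qed
  from this[of m] have "(f has_sum (\<Sum>i<m. g i)) {n. n mod int m < int m}" by simp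
  also have "{n. n mod int m < int m} = UNIV" using m by auto
  finally show ?thesis .
qed

lemma tendsto_fps_compose_left:
  fixes f :: "'b \<Rightarrow> 'a::comm_ring_1 fps"
  assumes "(f \<longlongrightarrow> a) F"
  shows "((\<lambda>x. f x oo b) \<longlongrightarrow> a oo b) F"
proof (rule tendsto_fpsI)
  fix n
  have "\<forall>\<^sub>F x in F. \<forall>k\<in>{..n}. f x $ k = a $ k" 
    using assms unfolding tendsto_fps_iff by (intro eventually_ball_finite) auto
  thus "\<forall>\<^sub>F x in F. (f x oo b) $ n = (a oo b) $ n"
    by eventually_elim (auto simp: fps_compose_nth intro!: sum.cong)
qed

lemma has_sum_fps_compose:
  fixes F :: "'b \<Rightarrow> 'a::comm_ring_1 fps"
  assumes "(F has_sum S) A"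
  shows "((\<lambda>x. F x oo b) has_sum (S oo b)) A"
  using tendsto_fps_compose_left[of "sum F" S "finite_subsets_at_top A" b] assms
  unfolding has_sum_def by (simp add: fps_compose_sum_distrib)

text \<open>Pairing n with -n turns a bilateral sum into a one-sided series, the form in which K is
  given. The symmetric intervals are cofinal among finite sets of integers.\<close>

lemma has_sum_int_imp_sums:
  fixes h :: "int \<Rightarrow> 'a::{topological_comm_monoid_add, ab_group_add}"
  assumes "(h has_sum (h 0 + S)) UNIV"
  shows "(\<lambda>n. h (int (n + 1)) + h (- int (n + 1))) sums S"
proof -
  have "filterlim (\<lambda>N. {-int N..int N}) (finite_subsets_at_top UNIV) sequentially"
    unfolding filterlim_finite_subsets_at_top
  proof (intro allI impI)
    fix X :: "int set" assume X: "finite X \<and> X \<subseteq> UNIV"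
    define M where "M = nat (\<Sum>x\<in>X. \<bar>x\<bar>)"
    have "\<bar>x\<bar> \<le> int M" if "x \<in> X" for x
      using X that by (simp add: M_def member_le_sum sum_nonneg)
    hence "X \<subseteq> {-int N..int N}" if "N \<ge> M" for N using that by fastforce
    thus "\<forall>\<^sub>F N in sequentially. finite {-int N..int N} \<and> X \<subseteq> {-int N..int N} \<and> {-int N..int N} \<subseteq> UNIV"
      by (auto simp: eventually_at_top_linorder)
  qed
  from filterlim_compose[OF assms[unfolded has_sum_def] this]
  have lim: "(\<lambda>N. sum h {-int N..int N}) \<longlonglongrightarrow> h 0 + S" .
  have eq: "sum h {-int N..int N} = h 0 + (\<Sum>n<N. h (int (n + 1)) + h (- int (n + 1)))" for N
  proof (induction N)
    case (Suc N)
    have "{-int (Suc N)..int (Suc N)} = insert (int (Suc N)) (insert (- int (Suc N)) {-int N..int N})"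
      by auto
    thus ?case using Suc by (simp add: add_ac)
  qed auto
  have "(\<lambda>N. - h 0 + sum h {-int N..int N}) \<longlonglongrightarrow> - h 0 + (h 0 + S)"
    by (intro tendsto_add lim tendsto_const)
  thus ?thesis unfolding sums_def eq by (simp add: add.assoc[symmetric])
qed

text \<open>Replacing q by q^m does not change the sign of the denominator exponent, so the same
  branch of the expansion is used on both sides.\<close>

lemma lambert_frac_compose:
  assumes "m > 0" "f = 0 \<longrightarrow> c \<noteq> 1" "f \<ge> 0 \<longrightarrow> e \<ge> 0" "f < 0 \<longrightarrow> e \<ge> f"
  shows "lambert_frac c (int m * e + int t) (int m * f) = fps_X ^ t * (lambert_frac c e f oo fps_X ^ m)"
proof -
  have m0: "(fps_X ^ m :: complex fps) $ 0 = 0" using assms by simp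
  have inv: "inverse (1 - cst c * fps_X ^ k) oo fps_X ^ m = inverse (1 - cst c * fps_X ^ (m * k))" 
    if "k = 0 \<longrightarrow> c \<noteq> 1" for k
  proof -
    have "(1 - cst c * fps_X ^ k) $ 0 \<noteq> 0" using that by (auto simp: power_0_left)
    thus ?thesis
      using m0 assms by (simp add: fps_inverse_compose fps_compose_sub_distrib fps_compose_mult_distrib fps_X_power_compose 
         flip: power_mult)
  qed
  show ?thesis
  proof (cases "f \<ge> 0")
    case True
    hence "int m * f \<ge> 0" "nat (int m * f) = m * nat f" "nat (int m * e + int t) = m * nat e + t"
      using assms by (auto simp: nat_mult_distrib nat_add_distrib)
    thus ?thesis using True assms m0
      by (simp add: lambert_frac_def fps_compose_mult_distrib fps_X_power_compose power_add inv flip: power_mult)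
  next
    case False
    have 1: "int m * f < 0" using False assms by (simp add: mult_less_0_iff)
    have "nat (int m * f') = m * nat f'" for f' using assms by (simp add: nat_mult_distrib)
    from this[of "-f"] have 2: "nat (- (int m * f)) = m * nat (- f)" by simp
    have "int m * e + int t - int m * f = int m * (e - f) + int t" by (simp add: algebra_simps)
    also have "nat \<dots> = m * nat (e - f) + t" using False assms by (simp add: nat_add_distrib nat_mult_distrib)
    finally have 3: "nat (int m * e + int t - int m * f) = m * nat (e - f) + t" .
    have "lambert_frac c (int m * e + int t) (int m * f) = 
       - cst c * (fps_X ^ (m * nat (e - f) + t) * inverse (1 - cst c * fps_X ^ (m * nat (- f))))"
      using 1 2 3 by (simp add: lambert_frac_def)
    moreover have "lambert_frac c e f oo fps_X ^ m = - cst c * (fps_X ^ (m * nat (e - f)) * inverse (1 - cst c * fps_X ^ (m * nat (- f))))"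
      using False assms m0
      by (simp add: lambert_frac_def fps_compose_mult_distrib fps_X_power_compose inv fps_compose_uminus flip: power_mult)
    ultimately show ?thesis by (simp add: power_add mult_ac)
  qed
qed


lemma lambert_frac_shift:
  assumes "f \<ge> 0 \<longrightarrow> e \<ge> 0" "f < 0 \<longrightarrow> e \<ge> f"
  shows "lambert_frac c (e + int t) f = fps_X ^ t * lambert_frac c e f"
proof (cases "f \<ge> 0")
  case True
  thus ?thesis using assms by (simp add: lambert_frac_def nat_add_distrib power_add mult_ac)
next
  case False
  hence "nat (e + int t - f) = nat (e - f) + t" using assms by auto
  thus ?thesis using False by (simp add: lambert_frac_def power_add mult_ac)
qed

lemma lambert_term_exponents':
  assumes "0 < s" "s < p" "s + r \<le> p"
  shows "int r + int p * n \<ge> 0 \<longrightarrow> int s * n \<ge> 0" "int r + int p * n < 0 \<longrightarrow> int s * n \<ge> int r + int p * n"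
proof -
  have *: "0 < int s" "int s < int p" "0 \<le> int r" "int s + int r \<le> int p" using assms by auto
  show "int r + int p * n \<ge> 0 \<longrightarrow> int s * n \<ge> 0"
  proof
    assume "0 \<le> int r + int p * n"
    hence "n \<ge> 0" by (rule lambert_term_exponents(1)[OF *])
    thus "0 \<le> int s * n" by simp
  qed
  show "int r + int p * n < 0 \<longrightarrow> int s * n \<ge> int r + int p * n"
    using lambert_term_exponents(2)[OF *, of n] by linarith
qed

text \<open>Kronecker's product (P;P)^2 (xy, P/(xy);P) / (x, P/x, y, P/y;P) for P = q^p, y = c q^s,
  x = c q^r and c^2 = 1.\<close>

definition theta_quot :: "complex \<Rightarrow> nat \<Rightarrow> nat \<Rightarrow> nat \<Rightarrow> complex fps" where
  "theta_quot c s r p = (qp p p)\<^sup>2 * qp (s + r) p * qp (p - s - r) p *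
            inverse (qpoch c r p * qpoch c (p - r) p * qpoch c s p * qpoch c (p - s) p)"

lemma lambert_term_has_sum_theta_quot:
  assumes "0 < s" "s < p" "s + r \<le> p" "c * c = 1" "c = 1 \<Longrightarrow> r > 0"
  shows "(lambert_term c s r p has_sum theta_quot c s r p) UNIV"
  using kronecker_fps[OF assms] by (simp add: theta_quot_def)

lemma powi_minus_one_odd:
  "(-1 :: complex) powi (5 * k + int i) = (-1) ^ i * (-1) powi k"
proof -
  have "(-1 :: complex) powi (5 * k + int i) = ((-1) powi 5) powi k * (-1) powi (int i)"
    by (subst power_int_add) (simp_all add: power_int_mult)
  also have "(-1 :: complex) powi 5 = -1" by simp
  finally show ?thesis by (simp add: mult.commute)
qed

text \<open>For n = 5k + i the denominator exponent is 5n = 5(i + 5k), so the inner sum has the same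
  shape in q^5, now with r = i. The sign is (-1)^i (-1)^k because 5 is odd.\<close>

lemma lambert_term_quintisect:
  assumes "0 < s" "s < 5" "s + i \<le> 5"
  shows "lambert_term (-1) s 0 5 (int 5 * k + int i) = cst ((-1) ^ i) * fps_X ^ (s * i) * (lambert_term (-1) s i 5 k oo fps_X ^ 5)"
proof -
  have "lambert_frac (-1) (int s * (5 * k + int i)) (5 * (5 * k + int i)) = 
        lambert_frac (-1) (int 5 * (int s * k) + int (s * i)) (int 5 * (int i + int 5 * k))"
    by (simp add: algebra_simps)
  also have "\<dots> = fps_X ^ (s * i) * (lambert_frac (-1) (int s * k) (int i + int 5 * k) oo fps_X ^ 5)"
    using lambert_term_exponents'[OF assms, of k] by (intro lambert_frac_compose) auto
  finally show ?thesis using powi_minus_one_odd[of k i]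
    by (simp add: lambert_term_def fps_compose_mult_distrib mult_ac flip: fps_const_mult)
qed

lemma theta_quot_quintisect_1:
  "theta_quot (-1) 1 0 5 = (\<Sum>i<5. cst ((-1) ^ i) * fps_X ^ i * (theta_quot (-1) 1 i 5 oo fps_X ^ 5))"
proof -
  have "(lambert_term (-1) 1 0 5 has_sum (\<Sum>i<5. cst ((-1) ^ i) * fps_X ^ i * (theta_quot (-1) 1 i 5 oo fps_X ^ 5))) UNIV"
  proof (rule has_sum_int_residues)
    fix i :: nat assume i: "i < 5"
    have "((\<lambda>k. cst ((-1) ^ i) * fps_X ^ i * (lambert_term (-1) 1 i 5 k oo fps_X ^ 5)) has_sum
       cst ((-1) ^ i) * fps_X ^ i * (theta_quot (-1) 1 i 5 oo fps_X ^ 5)) UNIV"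
      using i by (intro has_sum_cmult_right has_sum_fps_compose lambert_term_has_sum_theta_quot) auto
    thus "((\<lambda>k. lambert_term (-1) 1 0 5 (int 5 * k + int i)) has_sum
       cst ((-1) ^ i) * fps_X ^ i * (theta_quot (-1) 1 i 5 oo fps_X ^ 5)) UNIV"
      using lambert_term_quintisect[of 1 i] i by simp
  qed auto
  moreover have "(lambert_term (-1) 1 0 5 has_sum theta_quot (-1) 1 0 5) UNIV"
    by (rule lambert_term_has_sum_theta_quot) auto
  ultimately show ?thesis by (rule has_sum_unique[rotated])
qed

lemma has_sum_int_reflect:
  fixes f :: "int \<Rightarrow> 'a::topological_comm_monoid_add"
  shows "(f has_sum S) UNIV \<longleftrightarrow> ((\<lambda>k. f (- 1 - k)) has_sum S) UNIV"
  by (rule has_sum_reindex_bij_witness[of _ "\<lambda>k. -1 - k" "\<lambda>k. -1 - k"]) auto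

text \<open>Classes 0 to 3 satisfy 2 + i <= 5; class 4 does not. There k is replaced by -1 - k and
  the fraction reflected, which moves the class to parameters s = 3, r = 1.\<close>

lemma theta_quot_quintisect_2:
  "theta_quot (-1) 2 0 5 = (\<Sum>i<4. cst ((-1) ^ i) * fps_X ^ (2 * i) * (theta_quot (-1) 2 i 5 oo fps_X ^ 5))
     - fps_X ^ 3 * (theta_quot (-1) 3 1 5 oo fps_X ^ 5)"
proof -
  define g where "g i = (if i = 4 then - (fps_X ^ 3 * (theta_quot (-1) 3 1 5 oo fps_X ^ 5)) else 
     cst ((-1) ^ i) * fps_X ^ (2 * i) * (theta_quot (-1) 2 i 5 oo fps_X ^ 5))" for i :: nat
  have "(lambert_term (-1) 2 0 5 has_sum (\<Sum>i<5. g i)) UNIV"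
  proof (rule has_sum_int_residues)
    fix i :: nat assume i: "i < 5"
    show "((\<lambda>k. lambert_term (-1) 2 0 5 (int 5 * k + int i)) has_sum g i) UNIV"
    proof (cases "i = 4")
      case False
      have "((\<lambda>k. cst ((-1) ^ i) * fps_X ^ (2 * i) * (lambert_term (-1) 2 i 5 k oo fps_X ^ 5)) has_sum
         cst ((-1) ^ i) * fps_X ^ (2 * i) * (theta_quot (-1) 2 i 5 oo fps_X ^ 5)) UNIV"
        using i False by (intro has_sum_cmult_right has_sum_fps_compose lambert_term_has_sum_theta_quot) auto
      thus ?thesis
        using lambert_term_quintisect[of 2 i] i False by (simp add: g_def)
    next
      case True
      have "lambert_term (-1) 2 0 5 (int 5 * (- 1 - k) + int 4) = - (fps_X ^ 3) * (lambert_term (-1) 3 1 5 k oo fps_X ^ 5)" for k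
      proof -
        have "(-1 :: complex) powi (int 5 * (- 1 - k) + int 4) = (-1) powi (-1 - k)"
          using powi_minus_one_odd[of "-1 - k" 4] by simp
        also have "\<dots> = - ((-1) powi k)" by (simp add: power_int_diff) (simp add: power_int_def flip: power_one_over)
        finally have 1: "(-1 :: complex) powi (int 5 * (- 1 - k) + int 4) = - ((-1) powi k)" .
        \<comment> \<open>The index is n = -5k - 1. Reflection changes the exponents 2n and 5n into
          -3n = 5(3k) + 3 and -5n = 5(1 + 5k); its sign -c is +1, so the minus sign comes from
          (-1)^n alone.\<close>
        have "lambert_frac (-1) (int 2 * (int 5 * (- 1 - k) + int 4)) (int 0 + int 5 * (int 5 * (- 1 - k) + int 4)) = 
           lambert_frac (-1) (int 5 * (int 3 * k) + int 3) (int 5 * (int 1 + int 5 * k))"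
          by (subst lambert_frac_reflect) (auto simp: algebra_simps)
        also have "\<dots> = fps_X ^ 3 * (lambert_frac (-1) (int 3 * k) (int 1 + int 5 * k) oo fps_X ^ 5)"
          using lambert_term_exponents'[of 3 5 1 k] by (intro lambert_frac_compose) auto
        finally show ?thesis 
          by (simp only: lambert_term_def 1) 
             (simp add: fps_compose_mult_distrib mult_ac flip: fps_const_neg)
      qed
      moreover have "((\<lambda>k. - (fps_X ^ 3) * (lambert_term (-1) 3 1 5 k oo fps_X ^ 5)) has_sum
         (- (fps_X ^ 3) * (theta_quot (-1) 3 1 5 oo fps_X ^ 5))) UNIV"
        by (intro has_sum_cmult_right has_sum_fps_compose lambert_term_has_sum_theta_quot) auto
      ultimately show ?thesis unfolding True g_def
        by (subst has_sum_int_reflect) simp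
    qed
  qed auto
  moreover have "(lambert_term (-1) 2 0 5 has_sum theta_quot (-1) 2 0 5) UNIV"
    by (rule lambert_term_has_sum_theta_quot) auto
  ultimately have "theta_quot (-1) 2 0 5 = (\<Sum>i<5. g i)" by (rule has_sum_unique[rotated])
  also have "\<dots> = (\<Sum>i<4. g i) + g 4" by (simp add: eval_nat_numeral)
  also have "(\<Sum>i<4. g i) = (\<Sum>i<4. cst ((-1) ^ i) * fps_X ^ (2 * i) * (theta_quot (-1) 2 i 5 oo fps_X ^ 5))"
    by (rule sum.cong) (auto simp: g_def)
  finally show ?thesis by (simp add: g_def)
qed

text \<open>Putting n = 2k + i doubles s and the base exponent p, and moves r to r + p i.\<close>

lemma lambert_term_bisect:
  assumes "0 < s" "2 * s < 2 * p" "2 * s + (r + p * i) \<le> 2 * p"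
  shows "lambert_term 1 s r p (int 2 * k + int i) = fps_X ^ (s * i) * lambert_term 1 (2 * s) (r + p * i) (2 * p) k"
proof -
  have "lambert_frac 1 (int s * (2 * k + int i)) (int r + int p * (2 * k + int i)) = 
        lambert_frac 1 (int (2 * s) * k + int (s * i)) (int (r + p * i) + int (2 * p) * k)"
    by (simp add: algebra_simps)
  also have "\<dots> = fps_X ^ (s * i) * lambert_frac 1 (int (2 * s) * k) (int (r + p * i) + int (2 * p) * k)"
    using assms by (intro lambert_frac_shift lambert_term_exponents') auto
  finally show ?thesis by (simp add: lambert_term_def)
qed

lemma theta_quot_bisect_1: "theta_quot 1 1 1 5 = theta_quot 1 2 1 10 + fps_X * theta_quot 1 2 6 10"
proof -
  have "(lambert_term 1 1 1 5 has_sum (\<Sum>i<2. fps_X ^ i * theta_quot 1 2 (1 + 5 * i) 10)) UNIV"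
  proof (rule has_sum_int_residues)
    fix i :: nat assume i: "i < 2"
    have "((\<lambda>k. fps_X ^ i * lambert_term 1 2 (1 + 5 * i) 10 k) has_sum fps_X ^ i * theta_quot 1 2 (1 + 5 * i) 10) UNIV"
      using i by (intro has_sum_cmult_right lambert_term_has_sum_theta_quot) auto
    thus "((\<lambda>k. lambert_term 1 1 1 5 (int 2 * k + int i)) has_sum fps_X ^ i * theta_quot 1 2 (1 + 5 * i) 10) UNIV"
      using lambert_term_bisect[of 1 5 1 i] i by simp
  qed auto
  moreover have "(lambert_term 1 1 1 5 has_sum theta_quot 1 1 1 5) UNIV" by (rule lambert_term_has_sum_theta_quot) auto
  ultimately have "theta_quot 1 1 1 5 = (\<Sum>i<2. fps_X ^ i * theta_quot 1 2 (1 + 5 * i) 10)"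
    by (rule has_sum_unique[rotated])
  thus ?thesis by (simp add: eval_nat_numeral)
qed

text \<open>The odd class would have s = 4, r = 7 in base q^10, outside the range s + r <= 10.
  Reflection gives s = 6, r = 3 and, as c = 1, a minus sign. This sign, opposite to that in
  \<open>theta_quot_bisect_1\<close>, is what later isolates a single product.\<close>

lemma theta_quot_bisect_2: "theta_quot 1 2 2 5 = theta_quot 1 4 2 10 - fps_X * theta_quot 1 6 3 10"
proof -
  define g where "g i = (if i = 0 then theta_quot 1 4 2 10 else - (fps_X * theta_quot 1 6 3 10))" for i :: nat
  have "(lambert_term 1 2 2 5 has_sum (\<Sum>i<2. g i)) UNIV"
  proof (rule has_sum_int_residues)
    fix i :: nat assume i: "i < 2"
    show "((\<lambda>k. lambert_term 1 2 2 5 (int 2 * k + int i)) has_sum g i) UNIV"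
    proof (cases "i = 0")
      case True
      have "(lambert_term 1 4 2 10 has_sum theta_quot 1 4 2 10) UNIV" by (rule lambert_term_has_sum_theta_quot) auto
      thus ?thesis using lambert_term_bisect[of 2 5 2 0] True by (simp add: g_def)
    next
      case False
      hence i: "i = 1" using i by simp
      have "lambert_term 1 2 2 5 (int 2 * (- 1 - k) + int 1) = - fps_X * lambert_term 1 6 3 10 k" for k
      proof -
        have ne: "3 + 10 * k \<noteq> 0" by presburger
        have "lambert_frac 1 (int 2 * (int 2 * (- 1 - k) + int 1)) (int 2 + int 5 * (int 2 * (- 1 - k) + int 1)) = 
              - lambert_frac 1 (int 6 * k + int 1) (int 3 + int 10 * k)"
          using ne by (subst lambert_frac_reflect) (auto simp: algebra_simps)
        also have "lambert_frac 1 (int 6 * k + int 1) (int 3 + int 10 * k) = fps_X ^ 1 * lambert_frac 1 (int 6 * k) (int 3 + int 10 * k)"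
          by (intro lambert_frac_shift lambert_term_exponents') auto
        finally show ?thesis by (simp add: lambert_term_def)
      qed
      moreover have "((\<lambda>k. - fps_X * lambert_term 1 6 3 10 k) has_sum (- fps_X * theta_quot 1 6 3 10)) UNIV"
        by (intro has_sum_cmult_right lambert_term_has_sum_theta_quot) auto
      ultimately show ?thesis unfolding i g_def
        by (subst has_sum_int_reflect) simp
    qed
  qed auto
  moreover have "(lambert_term 1 2 2 5 has_sum theta_quot 1 2 2 5) UNIV" by (rule lambert_term_has_sum_theta_quot) auto
  ultimately have "theta_quot 1 2 2 5 = (\<Sum>i<2. g i)" by (rule has_sum_unique[rotated])
  thus ?thesis by (simp add: g_def eval_nat_numeral)
qed

section \<open>Evaluation at a primitive fifth root of unity\<close>

context
  fixes z :: complex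
  assumes z: "z ^ 5 = 1" "z \<noteq> 1"
begin

lemma fifth_root_nonzero: "z \<noteq> 0"
  using z by auto

text \<open>Termwise form of the Lambert series for K(-z^2): the denominator is completed to 1 +
  q^(5n), and each of the four resulting powers q^(sn) is one term, at n or -n, of S_1 or
  S_2.\<close>

lemma rank_term_fifth_root:
  assumes n: "n > 0"
  defines "a \<equiv> z + inverse z"
  defines "h \<equiv> \<lambda>n. cst (1 - a) * lambert_term (-1) 1 0 5 n + cst a * lambert_term (-1) 2 0 5 n"
  shows "rank_term (- (z\<^sup>2)) n = h (int n) + h (- int n)"
proof -
  define x where "x = (fps_X :: complex fps) ^ n"
  define A where "A = cst a"
  define S where "S = cst ((-1) ^ n)"
  define I where "I = inverse (1 + x ^ 5)"
  define w where "w = z\<^sup>2"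
  define D where "D = (1 - cst (- w) * x) * (1 - cst (inverse (- w)) * x)"
  have a2: "a\<^sup>2 = 1 - a"
    unfolding a_def fifth_root_inverse[OF z(1)] using fifth_root_sum[OF z] z(1) by algebra
  hence A2: "A\<^sup>2 = 1 - A" unfolding A_def fps_const_power by (simp flip: fps_const_sub)
  have w: "w + inverse w = -1 - a" "w * inverse w = 1"
  proof -
    show "w + inverse w = -1 - a" 
      unfolding w_def a_def fifth_root_inverse[OF z(1)] using fifth_root_sum[OF z] by algebra
    show "w * inverse w = 1" using fifth_root_nonzero by (simp add: w_def)
  qed
  have x0: "x $ 0 = 0" using n by (simp add: x_def)
  have D: "D = 1 + (- 1 - A) * x + x\<^sup>2"
  proof -
    have "cst w * cst (inverse w) = 1" using w(2) by simp
    moreover have "cst w + cst (inverse w) = - 1 - A" unfolding A_def fps_const_add w(1) by (simp flip: fps_const_sub fps_const_neg)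
    ultimately have "1 + (- 1 - A) * x + x\<^sup>2 = (1 + cst w * x) * (1 + cst (inverse w) * x)"
      using quadratic_factor(2) by metis
    thus ?thesis by (simp add: D_def flip: fps_const_neg)
  qed
  have I: "I * (1 + x ^ 5) = 1" unfolding I_def using x0 by (intro inverse_mult_eq_1) (simp add: fps_power_zeroth)
  have Di: "inverse D * D = 1" using x0 by (intro inverse_mult_eq_1) (simp add: D_def)
  \<comment> \<open>D is the factor of 1 + x^5 belonging to z^2 and its inverse; 1 + A x + x^2
    belongs to z and its inverse, and 1 + x to the root 1.\<close>
  have "D * ((1 + x) * (1 + A * x + x\<^sup>2)) = 1 + x ^ 5" unfolding D using A2 by algebra
  hence inv: "inverse D = (1 + x) * (1 + A * x + x\<^sup>2) * I" using I Di by algebra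
  have pref: "(1 - (- w)) * (1 - inverse (- w)) = 1 - a"
    using w by (simp add: algebra_simps)
  have "rank_term (- w) n = (1 - A) * S * x * inverse D"
    unfolding rank_term_def pref D_def x_def[symmetric] by (simp add: A_def S_def flip: fps_const_mult fps_const_sub)
  \<comment> \<open>The coefficient of x^2 and x^3 is (1 - A)(1 + A) = 1 - A^2 = A.\<close>
  also have "\<dots> = S * ((1 - A) * (x + x ^ 4) + A * (x\<^sup>2 + x ^ 3)) * I"
    unfolding inv using A2 by algebra
  finally have lhs: "rank_term (- w) n = S * ((1 - A) * (x + x ^ 4) + A * (x\<^sup>2 + x ^ 3)) * I" .
  have s1: "cst ((-1) powi (int n)) = S" "cst ((-1) powi (- int n)) = S"
    by (auto simp: S_def power_int_minus divide_inverse[symmetric] simp flip: power_one_over power_inverse)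
  \<comment> \<open>At -n the negative branch applies: q^(-sn) / (1 + q^(-5n)) = q^((5-s)n) / (1 +
    q^(5n)), so S_1 supplies x and x^4, and S_2 supplies x^2 and x^3.\<close>
  have k: "lambert_frac (-1) (int s * int n) (int 0 + int 5 * int n) = x ^ s * I" 
          "lambert_frac (-1) (int s * (- int n)) (int 0 + int 5 * (- int n)) = x ^ (5 - s) * I" if "s < 5" for s
  proof -
    have 1: "nat (int s * int n) = n * s" "nat (5 * int n) = n * 5" by (simp_all add: nat_mult_distrib)
    have "int s * - int n - 5 * (- int n) = int n * int (5 - s)" using that by (simp add: algebra_simps of_nat_diff)
    hence 2: "nat (int s * - int n - 5 * (- int n)) = n * (5 - s)" by (simp add: nat_mult_distrib)
    show "lambert_frac (-1) (int s * int n) (int 0 + int 5 * int n) = x ^ s * I"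
      using 1 by (simp add: lambert_frac_def x_def I_def power_mult flip: fps_const_neg)
    show "lambert_frac (-1) (int s * (- int n)) (int 0 + int 5 * (- int n)) = x ^ (5 - s) * I"
      using 1 2 n by (simp add: lambert_frac_def x_def I_def power_mult flip: fps_const_neg)
  qed
  have "h (int n) + h (- int n) = 
     (1 - A) * (S * (x ^ 1 * I)) + A * (S * (x ^ 2 * I)) + ((1 - A) * (S * (x ^ (5 - 1) * I)) + A * (S * (x ^ (5 - 2) * I)))"
    using k[of 1] k[of 2] unfolding h_def lambert_term_def s1 by (simp add: A_def flip: fps_const_sub)
  also have "\<dots> = S * ((1 - A) * (x + x ^ 4) + A * (x\<^sup>2 + x ^ 3)) * I"
    by (simp add: algebra_simps)
  finally show ?thesis using lhs by (simp add: w_def)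
qed

text \<open>Two evaluations of the same one-sided series for K(-z^2), one by
  \<open>rank_sums\<close> and one by Kronecker's identity, agree by uniqueness of sums.\<close>

lemma rank_sum_fifth_root:
  defines "a \<equiv> z + inverse z"
  shows "cst (1/2) * ((qp 1 1)\<^sup>2 * qpoch (z\<^sup>2) 1 1 * qpoch (inverse (z\<^sup>2)) 1 1 *
       inverse ((qpoch (-1) 1 1)\<^sup>2 * qpoch (- (z\<^sup>2)) 1 1 * qpoch (- inverse (z\<^sup>2)) 1 1)) = 
         cst (1 - a) * theta_quot (-1) 1 0 5 + cst a * theta_quot (-1) 2 0 5"
proof -
  define h where "h = (\<lambda>n. cst (1 - a) * lambert_term (-1) 1 0 5 n + cst a * lambert_term (-1) 2 0 5 n)"
  have "(h has_sum (cst (1 - a) * theta_quot (-1) 1 0 5 + cst a * theta_quot (-1) 2 0 5)) UNIV"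
    unfolding h_def by (intro has_sum_add has_sum_cmult_right lambert_term_has_sum_theta_quot) auto
  \<comment> \<open>Each Lambert series has central term 1/(1 + 1), and the weights 1 - a and a add
    up to 1; this matches the 1/2 in K.\<close>
  moreover have h0: "h 0 = cst (1/2)"
  proof -
    have "inverse (1 + 1 :: complex fps) = cst (1/2)"
      by (metis fps_const_1_eq_1 fps_const_add fps_const_inverse inverse_eq_divide one_add_one)
    hence "lambert_term (-1) s 0 5 0 = cst (1/2)" for s
      by (simp add: lambert_term_def lambert_frac_def flip: fps_const_neg)
    hence "h 0 = cst ((1 - a) * (1/2) + a * (1/2))" by (simp add: h_def)
    also have "(1 - a) * (1/2) + a * (1/2) = 1/2" by (simp add: field_simps)
    finally show ?thesis .
  qed
  ultimately have "(\<lambda>n. h (int (n + 1)) + h (- int (n + 1))) sums 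
      (cst (1 - a) * theta_quot (-1) 1 0 5 + cst a * theta_quot (-1) 2 0 5 - cst (1/2))"
    by (intro has_sum_int_imp_sums) (simp add: h0)
  hence "(\<lambda>n. rank_term (- (z\<^sup>2)) (n + 1)) sums 
      (cst (1 - a) * theta_quot (-1) 1 0 5 + cst a * theta_quot (-1) 2 0 5 - cst (1/2))"
    using rank_term_fifth_root[folded a_def] by (simp add: h_def)
  moreover have "- (z\<^sup>2) \<noteq> 0" using fifth_root_nonzero by simp
  from rank_sums[OF this] 
  have "(\<lambda>n. rank_term (- (z\<^sup>2)) (n + 1)) sums
     (cst (1/2) * ((qp 1 1)\<^sup>2 * qpoch (z\<^sup>2) 1 1 * qpoch (inverse (z\<^sup>2)) 1 1 *
       inverse ((qpoch (-1) 1 1)\<^sup>2 * qpoch (- (z\<^sup>2)) 1 1 * qpoch (- inverse (z\<^sup>2)) 1 1)) - cst (1/2))"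
    by simp
  ultimately show ?thesis using sums_unique2 by fastforce
qed

text \<open>Expanding (-q^5;q^5)/(q^5;q^5) by \<open>qpoch_fifth_roots\<close> with c = -1 and c = 1
  produces the z^2 factors inverted, so they cancel those of K(-z^2) and leave the z factors of
  K(z).\<close>

lemma theta_quotient_fifth_root:
  "qpoch (-1) 1 1 / qp 1 1 * (cst (1/2) * ((qp 1 1)\<^sup>2 * qpoch (- z) 1 1 * qpoch (- inverse z) 1 1 *
       inverse ((qpoch (-1) 1 1)\<^sup>2 * qpoch z 1 1 * qpoch (inverse z) 1 1))) =
   qpoch (-1) 5 5 / qp 5 5 * (cst (1/2) * ((qp 1 1)\<^sup>2 * qpoch (z\<^sup>2) 1 1 * qpoch (inverse (z\<^sup>2)) 1 1 *
       inverse ((qpoch (-1) 1 1)\<^sup>2 * qpoch (- (z\<^sup>2)) 1 1 * qpoch (- inverse (z\<^sup>2)) 1 1)))"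
proof -
  define T where "T = (\<lambda>c. fps_to_fls (qpoch c 1 1))"
  have nz0: "qpoch c 1 1 $ 0 = 1" "qp 5 5 $ 0 = 1" for c by (simp_all add: qpoch_nth_0)
  have T0: "T c \<noteq> 0" for c
  proof -
    have "qpoch c 1 1 \<noteq> 0" using nz0(1)[of c] by force
    thus ?thesis by (simp add: T_def)
  qed
  have 5: "fps_to_fls (qp 5 5) = T 1 * (T z * T (inverse z)) * (T (z\<^sup>2) * T (inverse (z\<^sup>2)))"
          "fps_to_fls (qpoch (-1) 5 5) = T (-1) * (T (-z) * T (- inverse z)) * (T (- (z\<^sup>2)) * T (- inverse (z\<^sup>2)))"
    using arg_cong[OF qpoch_fifth_roots[OF z, of 1], of fps_to_fls] 
          arg_cong[OF qpoch_fifth_roots[OF z, of "-1"], of fps_to_fls]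
    by (simp_all add: T_def fls_times_fps_to_fls)
  have d1: "fps_to_fls (qpoch (-1) 1 1 / qp 1 1) = T (-1) / T 1"
    by (subst fps_to_fls_divide_unit) (simp_all add: nz0 T_def del: One_nat_def)
  have d5: "fps_to_fls (qpoch (-1) 5 5 / qp 5 5) = (T (-1) * (T (-z) * T (- inverse z)) * (T (- (z\<^sup>2)) * T (- inverse (z\<^sup>2)))) / 
     (T 1 * (T z * T (inverse z)) * (T (z\<^sup>2) * T (inverse (z\<^sup>2))))"
    unfolding 5[symmetric] by (rule fps_to_fls_divide_unit) (simp add: nz0)
  have tq: "fps_to_fls ((qp 1 1)\<^sup>2 * qpoch a 1 1 * qpoch b 1 1 * 
       inverse ((qpoch (-1) 1 1)\<^sup>2 * qpoch c 1 1 * qpoch d 1 1)) = (T 1)\<^sup>2 * T a * T b / ((T (-1))\<^sup>2 * T c * T d)" for a b c d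
    by (subst fps_to_fls_mult_inverse)
       (simp_all add: nz0 fps_power_zeroth T_def fls_times_fps_to_fls fps_to_fls_power del: One_nat_def)
  have L1: "fps_to_fls (qpoch (-1) 1 1 / qp 1 1 * (cst (1/2) * ((qp 1 1)\<^sup>2 * qpoch (- z) 1 1 * qpoch (- inverse z) 1 1 *
       inverse ((qpoch (-1) 1 1)\<^sup>2 * qpoch z 1 1 * qpoch (inverse z) 1 1)))) = 
     T (-1) / T 1 * (fls_const (1/2) * ((T 1)\<^sup>2 * T (-z) * T (- inverse z) / ((T (-1))\<^sup>2 * T z * T (inverse z))))"
    unfolding fls_times_fps_to_fls[of "qpoch (-1) 1 1 / qp 1 1"] fls_times_fps_to_fls[of "cst (1/2)"] tq d1 by simp
  have L2: "fps_to_fls (qpoch (-1) 5 5 / qp 5 5 * (cst (1/2) * ((qp 1 1)\<^sup>2 * qpoch (z\<^sup>2) 1 1 * qpoch (inverse (z\<^sup>2)) 1 1 *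
       inverse ((qpoch (-1) 1 1)\<^sup>2 * qpoch (- (z\<^sup>2)) 1 1 * qpoch (- inverse (z\<^sup>2)) 1 1)))) = 
     (T (-1) * (T (-z) * T (- inverse z)) * (T (- (z\<^sup>2)) * T (- inverse (z\<^sup>2)))) / 
     (T 1 * (T z * T (inverse z)) * (T (z\<^sup>2) * T (inverse (z\<^sup>2)))) * 
     (fls_const (1/2) * ((T 1)\<^sup>2 * T (z\<^sup>2) * T (inverse (z\<^sup>2)) / ((T (-1))\<^sup>2 * T (-(z\<^sup>2)) * T (- inverse (z\<^sup>2)))))"
    unfolding fls_times_fps_to_fls[of "qpoch (-1) 5 5 / qp 5 5"] fls_times_fps_to_fls[of "cst (1/2)"] tq d5 by simp
  have mono: "A / B * (C * (B\<^sup>2 * X * Y / (A\<^sup>2 * U * V))) = 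
     (A * (X * Y) * (M * N)) / (B * (U * V) * (P * Q)) * (C * (B\<^sup>2 * P * Q / (A\<^sup>2 * M * N)))"
    if "A \<noteq> 0" "B \<noteq> 0" "U \<noteq> 0" "V \<noteq> 0" "M \<noteq> 0" "N \<noteq> 0" "P \<noteq> 0" "Q \<noteq> 0" for A B C X Y U V M N P Q :: "complex fls"
    using that by (simp add: divide_simps)
  show ?thesis unfolding fps_to_fls_eq_iff[symmetric] L1 L2 by (rule mono) (rule T0)+
qed

end


section \<open>Product identities as cancellations among ten products in base q^10\<close>

definition qp10 :: "nat \<Rightarrow> complex fls" where
  "qp10 j = fps_to_fls (qp j 10)"

lemma qpoch_nth_0_pos [simp]:
  "qpoch c (Suc j) (Suc d) $ 0 = 1" "qpoch c (numeral m) (Suc d) $ 0 = 1" 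
  "qpoch c (Suc j) (numeral n) $ 0 = 1" "qpoch c (numeral m) (numeral n) $ 0 = 1"
  by (simp_all add: qpoch_nth_0)

lemma qpoch_neq_0: "0 < j \<Longrightarrow> 0 < d \<Longrightarrow> qpoch c j d \<noteq> 0"
  using qpoch_nth_0[of j d c] by force

lemma qp10_nonzero: "0 < j \<Longrightarrow> qp10 j \<noteq> 0"
  by (simp add: qp10_def qpoch_neq_0)

lemma fls_qp_5: 
  assumes "0 < j" 
  shows "fps_to_fls (qp j 5) = qp10 j * qp10 (j + 5)"
  using qpoch_residues[of 5 2 1 j] by (simp add: qp10_def eval_nat_numeral fls_times_fps_to_fls)

lemma fls_qpoch_minus_5:
  assumes "0 < j" 
  shows "fps_to_fls (qpoch (-1) j 5) = qp10 (2 * j) / (qp10 j * qp10 (j + 5))"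
proof -
  have "fps_to_fls (qp j 5 * qpoch (-1) j 5) = qp10 (2 * j)"
    using qpoch_mult_uminus[of 5 1 j] by (simp add: qp10_def)
  thus ?thesis using qp10_nonzero[of j] qp10_nonzero[of "j + 5"] assms 
    by (simp add: fls_qp_5 fls_times_fps_to_fls field_simps)
qed

lemma fls_qpoch_minus_0_5:
  "fps_to_fls (qpoch (-1) 0 5) = 2 / qp10 5"
proof -
  have "fps_to_fls (qpoch (-1) 0 5) = 2 * fps_to_fls (qpoch (-1) 5 5)"
    by (simp add: qpoch_0 fls_times_fps_to_fls flip: fps_const_neg)
  thus ?thesis using qp10_nonzero[of 5] qp10_nonzero[of 10] by (simp add: fls_qpoch_minus_5)
qed

lemma fls_qp_1: 
  "fps_to_fls (qp 1 1) = qp10 1 * qp10 2 * qp10 3 * qp10 4 * qp10 5 * qp10 6 * qp10 7 * qp10 8 * qp10 9 * qp10 10"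
proof -
  have "{..<5 :: nat} = {0, 1, 2, 3, 4}" by auto
  hence "qp 1 1 = qp 1 5 * qp 2 5 * qp 3 5 * qp 4 5 * qp 5 5"
    using qpoch_residues[of 1 5 1 1] by (simp add: mult_ac eval_nat_numeral)
  thus ?thesis
    by (simp add: fls_qp_5 fls_times_fps_to_fls mult_ac del: One_nat_def)
qed

text \<open>(-q;q)/(q;q) = (q^2;q^2)/(q;q)^2, with both products split modulo 10.\<close>

lemma fls_overpartition:
  "fps_to_fls (qpoch (-1) 1 1 / qp 1 1) = 
     1 / ((qp10 1 * qp10 3 * qp10 5 * qp10 7 * qp10 9)\<^sup>2 * (qp10 2 * qp10 4 * qp10 6 * qp10 8 * qp10 10))"
proof -
  have "qp 1 1 * qpoch (-1) 1 1 = qp 2 2" using qpoch_mult_uminus[of 1 1 1] by (simp add: eval_nat_numeral)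
  moreover have "qp 2 2 = qp 2 10 * qp 4 10 * qp 6 10 * qp 8 10 * qp 10 10"
    using qpoch_residues[of 2 5 1 2] by (simp add: eval_nat_numeral)
  ultimately have "fps_to_fls (qp 1 1) * fps_to_fls (qpoch (-1) 1 1) = qp10 2 * qp10 4 * qp10 6 * qp10 8 * qp10 10"
    by (simp add: qp10_def flip: fls_times_fps_to_fls)
  hence e1: "fps_to_fls (qpoch (-1) 1 1) = qp10 2 * qp10 4 * qp10 6 * qp10 8 * qp10 10 / fps_to_fls (qp 1 1)"
    using qpoch_neq_0[of 1 1 1] by (simp add: field_simps)
  have e2: "fps_to_fls (qpoch (-1) 1 1 / qp 1 1) = fps_to_fls (qpoch (-1) 1 1) / fps_to_fls (qp 1 1)"
    by (rule fps_to_fls_divide_unit) simp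
  show ?thesis unfolding e2 e1 fls_qp_1
    by (simp add: qp10_nonzero power2_eq_square divide_simps del: One_nat_def)
qed

lemma fls_theta_quot:
  assumes "0 < s" "s < p" "s + r \<le> p" "r > 0 \<or> c \<noteq> 1"
  shows "fps_to_fls (theta_quot c s r p) = 
           (fps_to_fls (qp p p))\<^sup>2 * fps_to_fls (qp (s + r) p) * fps_to_fls (qp (p - s - r) p) /
           (fps_to_fls (qpoch c r p) * fps_to_fls (qpoch c (p - r) p) * fps_to_fls (qpoch c s p) * fps_to_fls (qpoch c (p - s) p))"
proof -
  have "qpoch c r p $ 0 \<noteq> 0" using assms by (intro qpoch_nth_0_nonzero) auto
  hence "(qpoch c r p * qpoch c (p - r) p * qpoch c s p * qpoch c (p - s) p) $ 0 \<noteq> 0"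
    using assms by (simp add: qpoch_nth_0)
  thus ?thesis unfolding theta_quot_def
    by (subst fps_to_fls_mult_inverse) (auto simp: fls_times_fps_to_fls fps_to_fls_power)
qed

abbreviation overpart :: "complex fps" where
  "overpart \<equiv> qpoch (-1) 1 1 / qp 1 1"

text \<open>This and the following evaluations are stated in q; they enter the dissection with q
  replaced by q^5, where \<open>overpart\<close> becomes the prefactor (-q^5;q^5)/(q^5;q^5).\<close>

lemma overpart_theta_quot_1:
  "overpart * theta_quot (-1) 1 1 5 = qp 4 10 * qp 6 10 * qp 10 10 / ((qp 2 10 * qp 8 10)\<^sup>2 * (qp 3 10 * qp 7 10))"
proof -
  have "fps_to_fls (qp 4 10 * qp 6 10 * qp 10 10 / ((qp 2 10 * qp 8 10)\<^sup>2 * (qp 3 10 * qp 7 10))) = 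
        qp10 4 * qp10 6 * qp10 10 / ((qp10 2 * qp10 8)\<^sup>2 * (qp10 3 * qp10 7))"
    by (subst fps_to_fls_divide_unit) (simp_all add: qp10_def fls_times_fps_to_fls fps_to_fls_power fps_power_zeroth)
  thus ?thesis unfolding fps_to_fls_eq_iff[symmetric] 
    unfolding fls_times_fps_to_fls[of overpart] fls_overpartition
    by (simp add: fls_theta_quot fls_qp_5 fls_qpoch_minus_5 qp10_nonzero divide_simps del: One_nat_def)
       (simp add: power2_eq_square mult_ac)
qed

text \<open>\<open>theta_quot\<close> is symmetric in s and r, so class 2 of S_1 and class 1 of S_2
  give the same product.\<close>

lemma overpart_theta_quot_2:
  "overpart * theta_quot (-1) 1 2 5 = qp 10 10 / ((qp 1 10 * qp 9 10) * (qp 4 10 * qp 6 10))"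
  "overpart * theta_quot (-1) 2 1 5 = qp 10 10 / ((qp 1 10 * qp 9 10) * (qp 4 10 * qp 6 10))"
proof -
  have *: "fps_to_fls (qp 10 10 / ((qp 1 10 * qp 9 10) * (qp 4 10 * qp 6 10))) = 
        qp10 10 / ((qp10 1 * qp10 9) * (qp10 4 * qp10 6))"
    by (subst fps_to_fls_divide_unit) (simp_all add: qp10_def fls_times_fps_to_fls)
  show "overpart * theta_quot (-1) 1 2 5 = qp 10 10 / ((qp 1 10 * qp 9 10) * (qp 4 10 * qp 6 10))"
    unfolding fps_to_fls_eq_iff[symmetric] *
    unfolding fls_times_fps_to_fls[of overpart] fls_overpartition
    by (simp add: fls_theta_quot fls_qp_5 fls_qpoch_minus_5 qp10_nonzero divide_simps del: One_nat_def)
       (simp add: power2_eq_square mult_ac)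
  moreover have "theta_quot (-1) 2 1 5 = theta_quot (-1) 1 2 5" by (simp add: theta_quot_def mult_ac numeral_2_eq_2 numeral_3_eq_3)
  ultimately show "overpart * theta_quot (-1) 2 1 5 = qp 10 10 / ((qp 1 10 * qp 9 10) * (qp 4 10 * qp 6 10))"
    by (simp only:)
qed

lemma overpart_theta_quot_3:
  "overpart * theta_quot (-1) 1 3 5 = qp 10 10 / (qp 2 5 * qp 3 5)"
  "overpart * theta_quot (-1) 3 1 5 = qp 10 10 / (qp 2 5 * qp 3 5)"
proof -
  have *: "fps_to_fls (qp 10 10 / (qp 2 5 * qp 3 5)) = qp10 10 / ((qp10 2 * qp10 7) * (qp10 3 * qp10 8))"
    by (subst fps_to_fls_divide_unit) (simp_all add: qp10_def[of 10] fls_qp_5 fls_times_fps_to_fls)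
  show "overpart * theta_quot (-1) 1 3 5 = qp 10 10 / (qp 2 5 * qp 3 5)"
    unfolding fps_to_fls_eq_iff[symmetric] *
    unfolding fls_times_fps_to_fls[of overpart] fls_overpartition
    by (simp add: fls_theta_quot fls_qp_5 fls_qpoch_minus_5 qp10_nonzero divide_simps del: One_nat_def)
       (simp add: power2_eq_square mult_ac)
  moreover have "theta_quot (-1) 3 1 5 = theta_quot (-1) 1 3 5" by (simp add: theta_quot_def mult_ac numeral_2_eq_2 numeral_3_eq_3)
  ultimately show "overpart * theta_quot (-1) 3 1 5 = qp 10 10 / (qp 2 5 * qp 3 5)"
    by (simp only:)
qed

lemma overpart_theta_quot_4:
  "overpart * theta_quot (-1) 2 2 5 = qp 2 10 * qp 8 10 * qp 10 10 / ((qp 1 10 * qp 9 10) * (qp 4 10 * qp 6 10)\<^sup>2)"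
proof -
  have "fps_to_fls (qp 2 10 * qp 8 10 * qp 10 10 / ((qp 1 10 * qp 9 10) * (qp 4 10 * qp 6 10)\<^sup>2)) = 
        qp10 2 * qp10 8 * qp10 10 / ((qp10 1 * qp10 9) * (qp10 4 * qp10 6)\<^sup>2)"
    by (subst fps_to_fls_divide_unit) (simp_all add: qp10_def fls_times_fps_to_fls fps_to_fls_power fps_power_zeroth)
  thus ?thesis unfolding fps_to_fls_eq_iff[symmetric] 
    unfolding fls_times_fps_to_fls[of overpart] fls_overpartition
    by (simp add: fls_theta_quot fls_qp_5 fls_qpoch_minus_5 qp10_nonzero divide_simps del: One_nat_def)
       (simp add: power2_eq_square mult_ac)
qed

text \<open>In both cases s + r = 5, and the numerator contains (q^0;q^5) = 0.\<close>

lemma theta_quot_vanish: "theta_quot (-1) 1 4 5 = 0" "theta_quot (-1) 2 3 5 = 0"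
  by (simp_all add: theta_quot_def qpoch_0)

lemma overpart_theta_quot_0:
  "overpart * theta_quot (-1) 1 0 5 = (qp 5 5)^2 * qp 4 10 * qp 6 10 / (cst 2 * qp 10 10 * (qp 2 5 * qp 3 5)^2)"
proof -
  have *: "fps_to_fls ((qp 5 5)^2 * qp 4 10 * qp 6 10 / (cst 2 * qp 10 10 * (qp 2 5 * qp 3 5)^2)) = 
        (qp10 5 * qp10 10)\<^sup>2 * qp10 4 * qp10 6 / (2 * qp10 10 * (qp10 2 * qp10 7 * (qp10 3 * qp10 8))\<^sup>2)"
    by (subst fps_to_fls_divide_unit) 
       (simp_all add: fls_qp_5 fls_const_numeral qp10_def[symmetric] fls_times_fps_to_fls fps_to_fls_power fps_power_zeroth)
  show ?thesis unfolding fps_to_fls_eq_iff[symmetric] *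
    unfolding fls_times_fps_to_fls[of overpart] fls_overpartition
    by (simp add: fls_theta_quot fls_qp_5 fls_qpoch_minus_5 fls_qpoch_minus_0_5 qp10_nonzero divide_simps del: One_nat_def)
       (simp add: power2_eq_square mult_ac)
qed

text \<open>The two bisections evaluate the difference of the quotients
  (q^2,q^3;q^5)/(-q^2,-q^3;q^5) and (q,q^4;q^5)/(-q,-q^4;q^5) as a single product.\<close>
lemma overpart_theta_quot_0_diff:
  "overpart * theta_quot (-1) 2 0 5 = overpart * theta_quot (-1) 1 0 5 + 
     fps_X * qp 10 10 / (qp 3 10 * qp 4 10 * qp 6 10 * qp 7 10)"
proof -
  define X where "X = (fls_X :: complex fls)"
  have nz: "qp10 1 \<noteq> 0" "qp10 2 \<noteq> 0" "qp10 3 \<noteq> 0" "qp10 4 \<noteq> 0" "qp10 5 \<noteq> 0" "qp10 6 \<noteq> 0" 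
    "qp10 7 \<noteq> 0" "qp10 8 \<noteq> 0" "qp10 9 \<noteq> 0" "qp10 10 \<noteq> 0" by (simp_all add: qp10_nonzero)
  have "fps_to_fls (theta_quot 1 1 1 5) = fps_to_fls (theta_quot 1 2 1 10) + X * fps_to_fls (theta_quot 1 2 6 10)"
    using arg_cong[OF theta_quot_bisect_1, of fps_to_fls] by (simp add: X_def fls_times_fps_to_fls)
  moreover have "fps_to_fls (theta_quot 1 1 1 5) = (qp10 5 * qp10 10)\<^sup>2 * (qp10 2 * qp10 7) * (qp10 3 * qp10 8) / (qp10 1 * qp10 6 * (qp10 4 * qp10 9) * (qp10 1 * qp10 6) * (qp10 4 * qp10 9))"
    by (subst fls_theta_quot) (simp_all add: fls_qp_5 del: One_nat_def)
  moreover have "fps_to_fls (theta_quot 1 2 1 10) = (qp10 10)\<^sup>2 * qp10 3 * qp10 7 / (qp10 1 * qp10 9 * qp10 2 * qp10 8)"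
    "fps_to_fls (theta_quot 1 2 6 10) = (qp10 10)\<^sup>2 * qp10 8 * qp10 2 / (qp10 6 * qp10 4 * qp10 2 * qp10 8)"
    unfolding qp10_def by (subst fls_theta_quot; simp)+
  ultimately have 1: "(qp10 5 * qp10 10)\<^sup>2 * (qp10 2 * qp10 7) * (qp10 3 * qp10 8) / (qp10 1 * qp10 6 * (qp10 4 * qp10 9) * (qp10 1 * qp10 6) * (qp10 4 * qp10 9)) = 
     (qp10 10)\<^sup>2 * qp10 3 * qp10 7 / (qp10 1 * qp10 9 * qp10 2 * qp10 8) + 
     X * ((qp10 10)\<^sup>2 * qp10 8 * qp10 2 / (qp10 6 * qp10 4 * qp10 2 * qp10 8))"
    by (simp only:)
  have "fps_to_fls (theta_quot 1 2 2 5) = fps_to_fls (theta_quot 1 4 2 10) - X * fps_to_fls (theta_quot 1 6 3 10)"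
    using arg_cong[OF theta_quot_bisect_2, of fps_to_fls] by (simp add: X_def fls_times_fps_to_fls)
  moreover have "fps_to_fls (theta_quot 1 2 2 5) = (qp10 5 * qp10 10)\<^sup>2 * (qp10 4 * qp10 9) * (qp10 1 * qp10 6) / (qp10 2 * qp10 7 * (qp10 3 * qp10 8) * (qp10 2 * qp10 7) * (qp10 3 * qp10 8))"
    by (subst fls_theta_quot) (simp_all add: fls_qp_5)
  moreover have "fps_to_fls (theta_quot 1 4 2 10) = (qp10 10)\<^sup>2 * qp10 6 * qp10 4 / (qp10 2 * qp10 8 * qp10 4 * qp10 6)"
    "fps_to_fls (theta_quot 1 6 3 10) = (qp10 10)\<^sup>2 * qp10 9 * qp10 1 / (qp10 3 * qp10 7 * qp10 6 * qp10 4)"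
    unfolding qp10_def by (subst fls_theta_quot; simp)+
  ultimately have 2: "(qp10 5 * qp10 10)\<^sup>2 * (qp10 4 * qp10 9) * (qp10 1 * qp10 6) / (qp10 2 * qp10 7 * (qp10 3 * qp10 8) * (qp10 2 * qp10 7) * (qp10 3 * qp10 8)) = 
     (qp10 10)\<^sup>2 * qp10 6 * qp10 4 / (qp10 2 * qp10 8 * qp10 4 * qp10 6) - 
     X * ((qp10 10)\<^sup>2 * qp10 9 * qp10 1 / (qp10 3 * qp10 7 * qp10 6 * qp10 4))"
    by (simp only:)
  \<comment> \<open>U and V are, up to a common factor, the two halves of either bisection. They
    occur as U + V and, because of the reflection sign, as U - V, so the difference retains only
    V.\<close>
  define U where "U = 1 / (qp10 1 * qp10 9 * qp10 2 * qp10 8)"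
  define V where "V = X / (qp10 3 * qp10 7 * qp10 4 * qp10 6)"
  have e2: "fps_to_fls (overpart * theta_quot (-1) 2 0 5) = qp10 10 / 2 * (U + V)"
  proof -
    \<comment> \<open>Up to an explicit denominator this is the product side of
      \<open>theta_quot_bisect_1\<close>; the quotient with s = 1 below is likewise that of
      \<open>theta_quot_bisect_2\<close>.\<close>
    have "fps_to_fls (overpart * theta_quot (-1) 2 0 5) = 
       (qp10 5 * qp10 10)\<^sup>2 * (qp10 2 * qp10 7) * (qp10 3 * qp10 8) / (qp10 1 * qp10 6 * (qp10 4 * qp10 9) * (qp10 1 * qp10 6) * (qp10 4 * qp10 9)) / 
       (2 * qp10 10 * qp10 3 * qp10 7)"
      unfolding fls_times_fps_to_fls[of overpart] fls_overpartition
      by (simp add: fls_theta_quot fls_qp_5 fls_qpoch_minus_5 fls_qpoch_minus_0_5 nz divide_simps del: One_nat_def)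
         (simp add: power2_eq_square mult_ac)
    also have "\<dots> = qp10 10 / 2 * (U + V)"
      unfolding 1 U_def V_def by (simp add: nz divide_simps del: One_nat_def) (simp add: power2_eq_square algebra_simps)
    finally show ?thesis .
  qed
  have e1: "fps_to_fls (overpart * theta_quot (-1) 1 0 5) = qp10 10 / 2 * (U - V)"
  proof -
    have "fps_to_fls (overpart * theta_quot (-1) 1 0 5) = 
       (qp10 5 * qp10 10)\<^sup>2 * (qp10 4 * qp10 9) * (qp10 1 * qp10 6) / (qp10 2 * qp10 7 * (qp10 3 * qp10 8) * (qp10 2 * qp10 7) * (qp10 3 * qp10 8)) / 
       (2 * qp10 10 * qp10 1 * qp10 9)"
      unfolding fls_times_fps_to_fls[of overpart] fls_overpartition
      by (simp add: fls_theta_quot fls_qp_5 fls_qpoch_minus_5 fls_qpoch_minus_0_5 nz divide_simps del: One_nat_def)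
         (simp add: power2_eq_square mult_ac)
    also have "\<dots> = qp10 10 / 2 * (U - V)"
      unfolding 2 U_def V_def by (simp add: nz divide_simps del: One_nat_def) (simp add: power2_eq_square algebra_simps)
    finally show ?thesis .
  qed
  have "fps_to_fls (fps_X * qp 10 10 / (qp 3 10 * qp 4 10 * qp 6 10 * qp 7 10)) = qp10 10 * V"
    by (subst fps_to_fls_divide_unit) (simp_all add: qp10_def X_def V_def fls_times_fps_to_fls mult_ac)
  moreover have "qp10 10 / 2 * (U + V) = qp10 10 / 2 * (U - V) + qp10 10 * V" by (simp add: field_simps)
  ultimately show ?thesis unfolding fps_to_fls_eq_iff[symmetric] fps_to_fls_plus e1 e2 by simp
qed


section \<open>Assembly of the five residue classes\<close>

theorem theorem2p14:
  fixes \<zeta> :: complex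
  assumes "\<zeta> ^ 5 = 1" and "\<zeta> \<noteq> 1"
  shows "qpoch (-1) 1 1 / qp 1 1 *
           (fps_const (1/2) +
            (\<Sum>n. fps_const ((1 - \<zeta>) * (1 - inverse \<zeta>) * (-1) ^ (n+1)) * fps_X ^ (n+1)
                 / ((1 - fps_const \<zeta> * fps_X ^ (n+1)) * (1 - fps_const (inverse \<zeta>) * fps_X ^ (n+1)))))
         = (\<Sum>r\<le>4. fps_X ^ r * (B r \<zeta> oo fps_X ^ 5))"
proof -
  define a where "a = \<zeta> + inverse \<zeta>"
  define A where "A = cst a"
  define Y where "Y = (fps_X ^ 5 :: complex fps)"
  define G where "G = (\<lambda>s i. theta_quot (-1) s i 5 oo Y)"
  define E where "E = overpart oo Y"
  have z0: "\<zeta> \<noteq> 0" using assms by auto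
  have Y0: "Y $ 0 = 0" by (simp add: Y_def)
  have summand: "fps_const ((1 - \<zeta>) * (1 - inverse \<zeta>) * (-1) ^ (n+1)) * fps_X ^ (n+1)
                 / ((1 - fps_const \<zeta> * fps_X ^ (n+1)) * (1 - fps_const (inverse \<zeta>) * fps_X ^ (n+1))) = 
        rank_term \<zeta> (n + 1)" for n
    unfolding rank_term_def by (rule fps_divide_unit) simp
  have E: "E = qpoch (-1) 5 5 / qp 5 5"
    unfolding E_def Y_def by (subst fps_divide_compose) (simp_all add: qpoch_compose)
  have "qpoch (-1) 1 1 / qp 1 1 *
           (fps_const (1/2) +
            (\<Sum>n. fps_const ((1 - \<zeta>) * (1 - inverse \<zeta>) * (-1) ^ (n+1)) * fps_X ^ (n+1)
                 / ((1 - fps_const \<zeta> * fps_X ^ (n+1)) * (1 - fps_const (inverse \<zeta>) * fps_X ^ (n+1))))) = 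
        E * (cst (1 - a) * theta_quot (-1) 1 0 5 + cst a * theta_quot (-1) 2 0 5)"
    \<comment> \<open>The summed series is the product for K(z) minus 1/2, so the initial 1/2
      cancels. The product is exchanged for that of K(-z^2) and then for its Lambert series; the
      rewriting runs both sides to a common form.\<close>
    unfolding summand sums_unique[OF rank_sums[OF z0], symmetric] E a_def
      rank_sum_fifth_root[OF assms, symmetric] theta_quotient_fifth_root[OF assms, symmetric]
    by (simp only: add_diff_cancel_left' add_diff_eq diff_add_cancel add.commute)
  also have "cst (1 - a) = 1 - A" by (simp add: A_def flip: fps_const_sub)
  also have "theta_quot (-1) 1 0 5 = G 1 0 - fps_X * G 1 1 + fps_X ^ 2 * G 1 2 - fps_X ^ 3 * G 1 3"
  proof -
    have "(\<Sum>i<5. f i) = f 0 + f 1 + f 2 + f 3 + f 4" for f :: "nat \<Rightarrow> complex fps"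
      by (simp add: eval_nat_numeral)
    thus ?thesis unfolding theta_quot_quintisect_1
      by (simp add: G_def Y_def theta_quot_vanish[unfolded One_nat_def] flip: fps_const_neg)
  qed
  also have "theta_quot (-1) 2 0 5 = G 2 0 - fps_X ^ 2 * G 2 1 + fps_X ^ 4 * G 2 2 - fps_X ^ 3 * G 3 1"
  proof -
    have "(\<Sum>i<4. f i) = f 0 + f 1 + f 2 + f 3" for f :: "nat \<Rightarrow> complex fps"
      by (simp add: eval_nat_numeral)
    thus ?thesis unfolding theta_quot_quintisect_2
      by (simp add: G_def Y_def theta_quot_vanish flip: fps_const_neg)
  qed
  finally have lhs: "qpoch (-1) 1 1 / qp 1 1 *
           (fps_const (1/2) +
            (\<Sum>n. fps_const ((1 - \<zeta>) * (1 - inverse \<zeta>) * (-1) ^ (n+1)) * fps_X ^ (n+1)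
                 / ((1 - fps_const \<zeta> * fps_X ^ (n+1)) * (1 - fps_const (inverse \<zeta>) * fps_X ^ (n+1))))) = 
        E * ((1 - A) * (G 1 0 - fps_X * G 1 1 + fps_X ^ 2 * G 1 2 - fps_X ^ 3 * G 1 3) + 
             cst a * (G 2 0 - fps_X ^ 2 * G 2 1 + fps_X ^ 4 * G 2 2 - fps_X ^ 3 * G 3 1))" .
  have EG: "E * G s i = (overpart * theta_quot (-1) s i 5) oo Y" for s i
    by (simp add: E_def G_def fps_compose_mult_distrib[OF Y0])
  have cc: "cst c * F oo Y = cst c * (F oo Y)" for c F
    by (simp add: fps_compose_mult_distrib[OF Y0])
  have c1: "cst (\<zeta> + inverse \<zeta> - 1) = A - 1" by (simp add: A_def a_def flip: fps_const_sub)
  have "1 - 2 * A = cst (1 - 2 * a)" by (simp add: A_def numeral_fps_const)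
  hence c2: "cst (1 - 2 * \<zeta> - 2 * inverse \<zeta>) = 1 - 2 * A" by (simp add: a_def algebra_simps)
  \<comment> \<open>The constant class is (1 - A) G 1 0 + A G 2 0, regrouped as G 1 0 plus A times a
    difference. That difference is the single product in the second summand of B_0.\<close>
  have b0: "B 0 \<zeta> oo Y = E * G 1 0 + A * (E * G 2 0 - E * G 1 0)"
    unfolding EG overpart_theta_quot_0_diff unfolding overpart_theta_quot_0 B_def B0_def
    by (simp add: fps_compose_add_distrib cc A_def a_def)
  have b1: "B 1 \<zeta> oo Y = (A - 1) * (E * G 1 1)"
    unfolding EG overpart_theta_quot_1 B_def B1_def by (simp add: cc flip: c1)
  have b2: "B 2 \<zeta> oo Y = (1 - 2 * A) * (E * G 1 2)"
    unfolding EG overpart_theta_quot_2 B_def B2_def by (simp add: cc flip: c2)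
  have b3: "B 3 \<zeta> oo Y = - (E * G 1 3)"
    unfolding EG overpart_theta_quot_3 B_def B3_def by (simp add: fps_compose_uminus)
  have b4: "B 4 \<zeta> oo Y = A * (E * G 2 2)"
    unfolding EG overpart_theta_quot_4 B_def B4_def by (simp add: cc A_def a_def)
  \<comment> \<open>These coincidences merge the remaining terms: at q^2 the coefficient is (1 - A)
    - A = 1 - 2A, and at q^3 it is -(1 - A) - A = -1.\<close>
  have eq: "E * G 2 1 = E * G 1 2" "E * G 3 1 = E * G 1 3"
    unfolding EG overpart_theta_quot_2 overpart_theta_quot_3 by simp_all
  have "(\<Sum>r\<le>4. fps_X ^ r * (B r \<zeta> oo fps_X ^ 5)) = 
    (B 0 \<zeta> oo Y) + fps_X * (B 1 \<zeta> oo Y) + fps_X ^ 2 * (B 2 \<zeta> oo Y) + fps_X ^ 3 * (B 3 \<zeta> oo Y) + fps_X ^ 4 * (B 4 \<zeta> oo Y)"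
    unfolding Y_def by (simp add: eval_nat_numeral)
  thus ?thesis unfolding lhs b0 b1 b2 b3 b4 A_def[symmetric] using eq by algebra
qed

end
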